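(* The calculus $\mathsf{qG}$ is decidable: there is an algorithm which, given formulas $\alpha,\beta$, decides whether $\vdash_{\mathsf{qG}}\alpha\Rightarrow\beta$.
   Context: Formulas are built from propositional variables by $\alpha\cdot\beta$, $\alpha\backslash\beta$, $\alpha\wedge\beta$, $\alpha\vee\beta$, $\neg\alpha$; sequents are $\alpha\Rightarrow\beta$ with single formulas. The calculus $\mathsf{qG}$ has axiom $(\mathrm{Id})\ \alpha\Rightarrow\alpha$ and rules (premises / conclusion): $(\mathrm{RES}\backslash)$ $\alpha\cdot\beta\Rightarrow\gamma$ / $\beta\Rightarrow\alpha\backslash\gamma$; $(\mathrm{RES}^-\backslash)$ $\beta\Rightarrow\alpha\backslash\gamma$ / $\alpha\cdot\beta\Rightarrow\gamma$; $(\wedge\mathrm{L})$ $\alpha\Rightarrow\beta$ / $\alpha\wedge\gamma\Rightarrow\beta$ and $\alpha\Rightarrow\beta$ / $\gamma\wedge\alpha\Rightarrow\beta$; $(\wedge\mathrm{R})$ $\alpha\Rightarrow\beta$, $\alpha\Rightarrow\gamma$ / $\alpha\Rightarrow\beta\wedge\gamma$; $(\vee\mathrm{L})$ $\alpha\Rightarrow\beta$, $\gamma\Rightarrow\beta$ / $\alpha\vee\gamma\Rightarrow\beta$; $(\vee\mathrm{R})$ $\alpha\Rightarrow\beta$ / $\alpha\Rightarrow\beta\vee\gamma$ and $\alpha\Rightarrow\beta$ / $\alpha\Rightarrow\gamma\vee\beta$; $(\neg)$ $\alpha\cdot\beta\Rightarrow\neg\gamma$ / $\gamma\cdot\beta\Rightarrow\neg\alpha$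 and its special case $(\mathrm{MN})$ $\alpha\Rightarrow\neg\gamma$ / $\gamma\Rightarrow\neg\alpha$; $(\mathrm{Cut})$ $\alpha\Rightarrow\beta$, $\beta\Rightarrow\gamma$ / $\alpha\Rightarrow\gamma$. *)

theory Defs
  imports Main "HOL-Library.Nat_Bijection"
begin

datatype form =
    Var nat
  | Fus form form  (infixr "\<^bold>\<cdot>" 75)
  | Res form form  (infixr "\<^bold>\<setminus>" 74)
  | Con form form  (infixr "\<^bold>\<and>" 72)
  | Dis form form  (infixr "\<^bold>\<or>" 71)
  | Neg form       ("\<^bold>\<not> _" [77] 77)

text \<open>\<open>MN\<close> is the rule \<open>neg\<close> with \<open>\<beta>\<close> absent. Sequents have exactly one formula
  on the left and there is no unit, so it is not a literal instance and is listed separately.\<close>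

inductive qG :: "form \<Rightarrow> form \<Rightarrow> bool"  ("\<turnstile> _ \<^bold>\<Rightarrow> _" [61, 61] 60) where
  Id: "\<turnstile> \<alpha> \<^bold>\<Rightarrow> \<alpha>"
| RES: "\<turnstile> \<alpha> \<^bold>\<cdot> \<beta> \<^bold>\<Rightarrow> \<gamma> \<Longrightarrow> \<turnstile> \<beta> \<^bold>\<Rightarrow> \<alpha> \<^bold>\<setminus> \<gamma>"
| RES_inv: "\<turnstile> \<beta> \<^bold>\<Rightarrow> \<alpha> \<^bold>\<setminus> \<gamma> \<Longrightarrow> \<turnstile> \<alpha> \<^bold>\<cdot> \<beta> \<^bold>\<Rightarrow> \<gamma>"
| conL1: "\<turnstile> \<alpha> \<^bold>\<Rightarrow> \<beta> \<Longrightarrow> \<turnstile> \<alpha> \<^bold>\<and> \<gamma> \<^bold>\<Rightarrow> \<beta>"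
| conL2: "\<turnstile> \<alpha> \<^bold>\<Rightarrow> \<beta> \<Longrightarrow> \<turnstile> \<gamma> \<^bold>\<and> \<alpha> \<^bold>\<Rightarrow> \<beta>"
| conR: "\<turnstile> \<alpha> \<^bold>\<Rightarrow> \<beta> \<Longrightarrow> \<turnstile> \<alpha> \<^bold>\<Rightarrow> \<gamma> \<Longrightarrow> \<turnstile> \<alpha> \<^bold>\<Rightarrow> \<beta> \<^bold>\<and> \<gamma>"
| disL: "\<turnstile> \<alpha> \<^bold>\<Rightarrow> \<beta> \<Longrightarrow> \<turnstile> \<gamma> \<^bold>\<Rightarrow> \<beta> \<Longrightarrow> \<turnstile> \<alpha> \<^bold>\<or> \<gamma> \<^bold>\<Rightarrow> \<beta>"
| disR1: "\<turnstile> \<alpha> \<^bold>\<Rightarrow> \<beta> \<Longrightarrow> \<turnstile> \<alpha> \<^bold>\<Rightarrow> \<beta> \<^bold>\<or> \<gamma>"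
| disR2: "\<turnstile> \<alpha> \<^bold>\<Rightarrow> \<beta> \<Longrightarrow> \<turnstile> \<alpha> \<^bold>\<Rightarrow> \<gamma> \<^bold>\<or> \<beta>"
| neg: "\<turnstile> \<alpha> \<^bold>\<cdot> \<beta> \<^bold>\<Rightarrow> \<^bold>\<not> \<gamma> \<Longrightarrow> \<turnstile> \<gamma> \<^bold>\<cdot> \<beta> \<^bold>\<Rightarrow> \<^bold>\<not> \<alpha>"
| MN: "\<turnstile> \<alpha> \<^bold>\<Rightarrow> \<^bold>\<not> \<gamma> \<Longrightarrow> \<turnstile> \<gamma> \<^bold>\<Rightarrow> \<^bold>\<not> \<alpha>"
| Cut: "\<turnstile> \<alpha> \<^bold>\<Rightarrow> \<beta> \<Longrightarrow> \<turnstile> \<beta> \<^bold>\<Rightarrow> \<gamma> \<Longrightarrow> \<turnstile> \<alpha> \<^bold>\<Rightarrow> \<gamma>"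

datatype recf =
    Zero
  | Succ
  | Proj nat
  | Comp recf "recf list"
  | Prec recf recf
  | Mu recf

text \<open>\<open>eval p xs y\<close>: the program \<open>p\<close> halts on the argument tuple \<open>xs\<close> with output \<open>y\<close>.
  In primitive recursion and minimization the recursion or search variable is the first argument.\<close>

inductive eval :: "recf \<Rightarrow> nat list \<Rightarrow> nat \<Rightarrow> bool" where
  Zero: "eval Zero xs 0"
| Succ: "eval Succ [x] (Suc x)"
| Proj: "i < length xs \<Longrightarrow> eval (Proj i) xs (xs ! i)"
| Comp: "list_all2 (\<lambda>g y. eval g xs y) gs ys \<Longrightarrow> eval f ys z \<Longrightarrow> eval (Comp f gs) xs z"
| Prec_0: "eval f xs y \<Longrightarrow> eval (Prec f g) (0 # xs) y"
| Prec_Suc: "eval (Prec f g) (k # xs) r \<Longrightarrow> eval g (k # r # xs) y \<Longrightarrow> eval (Prec f g) (Suc k # xs) y"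
| Mu: "eval f (y # xs) 0 \<Longrightarrow> (\<forall>z<y. \<exists>v. eval f (z # xs) (Suc v)) \<Longrightarrow> eval (Mu f) xs y"

inductive_cases eval_ZeroE: "eval Zero xs y"
inductive_cases eval_SuccE: "eval Succ xs y"
inductive_cases eval_ProjE: "eval (Proj i) xs y"
inductive_cases eval_CompE: "eval (Comp f gs) xs y"
inductive_cases eval_Prec0E: "eval (Prec f g) (0 # xs) y"
inductive_cases eval_PrecSucE: "eval (Prec f g) (Suc k # xs) y"
inductive_cases eval_MuE: "eval (Mu f) xs y"

lemma eval_deterministic: "eval p xs y \<Longrightarrow> eval p xs y' \<Longrightarrow> y = y'"
proof (induction arbitrary: y' rule: eval.induct)
  case (Zero xs)
  then show ?case by (rule eval_ZeroE) simp
next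
  case (Succ x)
  then show ?case by (rule eval_SuccE) simp
next
  case (Proj i xs)
  from Proj.prems show ?case by (rule eval_ProjE) simp
next
  case (Comp xs gs ys f z)
  from Comp.prems obtain ys' where ys': "list_all2 (\<lambda>g y. eval g xs y) gs ys'" "eval f ys' y'"
    by (rule eval_CompE)
  have "ys = ys'"
    using Comp.IH(1) ys'(1) by (auto simp: list_all2_conv_all_nth intro!: nth_equalityI)
  then show ?case using Comp.IH(2) ys'(2) by simp
next
  case (Prec_0 f xs y g)
  from Prec_0.prems have "eval f xs y'" by (rule eval_Prec0E)
  then show ?case by (rule Prec_0.IH)
next
  case (Prec_Suc f g k xs r y)
  from Prec_Suc.prems obtain r' where "eval (Prec f g) (k # xs) r'" "eval g (k # r' # xs) y'"
    by (rule eval_PrecSucE)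
  then show ?case using Prec_Suc.IH by metis
next
  case (Mu f y xs)
  from Mu.prems have y': "eval f (y' # xs) 0" "\<forall>z<y'. \<exists>v. eval f (z # xs) (Suc v)"
    by (auto elim: eval_MuE)
  have "\<not> y' < y" using Mu.IH(2) y'(1) by (metis nat.distinct(1))
  moreover have "\<not> y < y'" using Mu.IH(1) y'(2) by (metis nat.distinct(1))
  ultimately show ?case by simp
qed

text \<open>A Goedel numbering; the remainder modulo 6 identifies the main connective.\<close>

fun code :: "form \<Rightarrow> nat" where
  "code (Var n) = 6 * n"
| "code (\<alpha> \<^bold>\<cdot> \<beta>) = 6 * prod_encode (code \<alpha>, code \<beta>) + 1"
| "code (\<alpha> \<^bold>\<setminus> \<beta>) = 6 * prod_encode (code \<alpha>, code \<beta>) + 2"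
| "code (\<alpha> \<^bold>\<and> \<beta>) = 6 * prod_encode (code \<alpha>, code \<beta>) + 3"
| "code (\<alpha> \<^bold>\<or> \<beta>) = 6 * prod_encode (code \<alpha>, code \<beta>) + 4"
| "code (\<^bold>\<not> \<alpha>) = 6 * code \<alpha> + 5"

lemma code_surj: "\<exists>\<alpha>. code \<alpha> = n"
proof (induction n rule: less_induct)
  case (less n)
  define q where "q = n div 6"
  obtain a b where ab: "q = prod_encode (a, b)"
    by (metis prod_decode_inverse surj_pair)
  have n: "n = 6 * q + n mod 6" and r: "n mod 6 < 6"
    unfolding q_def by simp_all
  have le: "a \<le> q" "b \<le> q"
    unfolding ab by (rule le_prod_encode_1, rule le_prod_encode_2)
  show ?case
  proof (cases "n mod 6 = 0")
    case True
    then have "code (Var q) = n" using n by simp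
    then show ?thesis ..
  next
    case False
    then have lt: "a < n" "b < n" "q < n" using n le by linarith+
    obtain \<alpha> \<beta> \<gamma> where c: "code \<alpha> = a" "code \<beta> = b" "code \<gamma> = q"
      using less.IH lt by metis
    consider "n mod 6 = 1" | "n mod 6 = 2" | "n mod 6 = 3" | "n mod 6 = 4" | "n mod 6 = 5"
      using False r by linarith
    then show ?thesis
    proof cases
      case 1 then have "code (\<alpha> \<^bold>\<cdot> \<beta>) = n" using n ab c by simp
      then show ?thesis ..
    next
      case 2 then have "code (\<alpha> \<^bold>\<setminus> \<beta>) = n" using n ab c by simp
      then show ?thesis ..
    next
      case 3 then have "code (\<alpha> \<^bold>\<and> \<beta>) = n" using n ab c by simp
      then show ?thesis ..
    next
      case 4 then have "code (\<alpha> \<^bold>\<or> \<beta>) = n" using n ab c by simp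
      then show ?thesis ..
    next
      case 5 then have "code (\<^bold>\<not> \<gamma>) = n" using n c by simp
      then show ?thesis ..
    qed
  qed
qed

lemma code_inj: "code \<alpha> = code \<beta> \<Longrightarrow> \<alpha> = \<beta>"
proof (induction \<alpha> arbitrary: \<beta>)
  case (Var n)
  have "code \<beta> mod 6 = code (Var n) mod 6" using Var.prems by simp
  then show ?case using Var by (cases \<beta>) (simp_all add: mod_Suc)
next
  case (Fus a b)
  have "code \<beta> mod 6 = code (Fus a b) mod 6" using Fus.prems by simp
  then show ?case using Fus by (cases \<beta>) (simp_all add: mod_Suc)
next
  case (Res a b)
  have "code \<beta> mod 6 = code (Res a b) mod 6" using Res.prems by simp
  then show ?case using Res by (cases \<beta>) (simp_all add: mod_Suc)
next
  case (Con a b)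
  have "code \<beta> mod 6 = code (Con a b) mod 6" using Con.prems by simp
  then show ?case using Con by (cases \<beta>) (simp_all add: mod_Suc)
next
  case (Dis a b)
  have "code \<beta> mod 6 = code (Dis a b) mod 6" using Dis.prems by simp
  then show ?case using Dis by (cases \<beta>) (simp_all add: mod_Suc)
next
  case (Neg a)
  have "code \<beta> mod 6 = code (Neg a) mod 6" using Neg.prems by simp
  then show ?case using Neg by (cases \<beta>) (simp_all add: mod_Suc)
qed

lemma bij_code: "bij code"
  by (metis bijI code_inj code_surj injI surj_def)

definition decidable :: "(form \<Rightarrow> form \<Rightarrow> bool) \<Rightarrow> bool" where
  "decidable R \<longleftrightarrow>
     (\<exists>p. \<forall>\<alpha> \<beta>. eval p [code \<alpha>, code \<beta>] (if R \<alpha> \<beta> then 1 else 0))"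

end

theory Submission imports Defs begin

text \<open>
  Derivability turns out to be witnessed by derivations in which all formulas have codes below a
  computable bound \<open>B\<close>, even though cut is kept. To see this, let \<open>D\<close> be derivability with codes
  bounded by \<open>B\<close>, and interpret formulas as families of sets of formulas indexed by a finite
  grid of grades. At each grade the closed sets are the intersections of sets \<open>{x. D x z}\<close> for
  tests \<open>z\<close> of bounded code. Fusion by a label moves strictly up in the grid, so the elements that
  occur at a grade are built from those of lower grades and the tests from those of higher grades;
  this is what keeps all codes bounded. Every rule of the calculus is sound for this
  interpretation, and in the middle of the grid a small formula \<open>\<phi>\<close> lies in its own value, which is
  contained in \<open>{x. D x \<phi>}\<close>. Hence \<open>\<turnstile> \<alpha> \<Rightarrow> \<beta>\<close> implies \<open>D \<alpha> \<beta>\<close>.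

  Bounded derivability is then decided by checking that every relation on codes up to \<open>B\<close>
  closed under the rules contains the given sequent.
\<close>

section \<open>Derivations with bounded codes\<close>

text \<open>Side conditions bound only the compound formulas that a rule introduces; all other
  formulas inherit their bound from the premises.\<close>

inductive bqG :: "nat \<Rightarrow> form \<Rightarrow> form \<Rightarrow> bool" for B :: nat where
  Id: "code \<alpha> \<le> B \<Longrightarrow> bqG B \<alpha> \<alpha>"
| RES: "bqG B (\<alpha> \<^bold>\<cdot> \<beta>) \<gamma> \<Longrightarrow> code (\<alpha> \<^bold>\<setminus> \<gamma>) \<le> B \<Longrightarrow> bqG B \<beta> (\<alpha> \<^bold>\<setminus> \<gamma>)"
| RES_inv: "bqG B \<beta> (\<alpha> \<^bold>\<setminus> \<gamma>) \<Longrightarrow> code (\<alpha> \<^bold>\<cdot> \<beta>) \<le> B \<Longrightarrow> bqG B (\<alpha> \<^bold>\<cdot> \<beta>) \<gamma>"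
| conL1: "bqG B \<alpha> \<beta> \<Longrightarrow> code (\<alpha> \<^bold>\<and> \<gamma>) \<le> B \<Longrightarrow> bqG B (\<alpha> \<^bold>\<and> \<gamma>) \<beta>"
| conL2: "bqG B \<alpha> \<beta> \<Longrightarrow> code (\<gamma> \<^bold>\<and> \<alpha>) \<le> B \<Longrightarrow> bqG B (\<gamma> \<^bold>\<and> \<alpha>) \<beta>"
| conR: "bqG B \<alpha> \<beta> \<Longrightarrow> bqG B \<alpha> \<gamma> \<Longrightarrow> code (\<beta> \<^bold>\<and> \<gamma>) \<le> B \<Longrightarrow> bqG B \<alpha> (\<beta> \<^bold>\<and> \<gamma>)"
| disL: "bqG B \<alpha> \<beta> \<Longrightarrow> bqG B \<gamma> \<beta> \<Longrightarrow> code (\<alpha> \<^bold>\<or> \<gamma>) \<le> B \<Longrightarrow> bqG B (\<alpha> \<^bold>\<or> \<gamma>) \<beta>"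
| disR1: "bqG B \<alpha> \<beta> \<Longrightarrow> code (\<beta> \<^bold>\<or> \<gamma>) \<le> B \<Longrightarrow> bqG B \<alpha> (\<beta> \<^bold>\<or> \<gamma>)"
| disR2: "bqG B \<alpha> \<beta> \<Longrightarrow> code (\<gamma> \<^bold>\<or> \<beta>) \<le> B \<Longrightarrow> bqG B \<alpha> (\<gamma> \<^bold>\<or> \<beta>)"
| neg: "bqG B (\<alpha> \<^bold>\<cdot> \<beta>) (\<^bold>\<not> \<gamma>) \<Longrightarrow> code (\<gamma> \<^bold>\<cdot> \<beta>) \<le> B \<Longrightarrow> code (\<^bold>\<not> \<alpha>) \<le> B \<Longrightarrow> bqG B (\<gamma> \<^bold>\<cdot> \<beta>) (\<^bold>\<not> \<alpha>)"
| MN: "bqG B \<alpha> (\<^bold>\<not> \<gamma>) \<Longrightarrow> code (\<^bold>\<not> \<alpha>) \<le> B \<Longrightarrow> bqG B \<gamma> (\<^bold>\<not> \<alpha>)"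
| Cut: "bqG B \<alpha> \<beta> \<Longrightarrow> bqG B \<beta> \<gamma> \<Longrightarrow> bqG B \<alpha> \<gamma>"

lemma bqG_imp_qG: "bqG B \<alpha> \<beta> \<Longrightarrow> \<turnstile> \<alpha> \<^bold>\<Rightarrow> \<beta>"
  by (induction rule: bqG.induct)
     (rule qG.Id, erule qG.RES, erule qG.RES_inv, erule qG.conL1, erule qG.conL2, erule (1) qG.conR,
      erule (1) qG.disL, erule qG.disR1, erule qG.disR2, erule qG.neg, erule qG.MN, erule (1) qG.Cut)

section \<open>Derived rules under a code bound\<close>

lemma code_subformula_less:
  "code \<alpha> < code (\<alpha> \<^bold>\<cdot> \<beta>)" "code \<beta> < code (\<alpha> \<^bold>\<cdot> \<beta>)"
  "code \<alpha> < code (\<alpha> \<^bold>\<setminus> \<beta>)" "code \<beta> < code (\<alpha> \<^bold>\<setminus> \<beta>)"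
  "code \<alpha> < code (\<alpha> \<^bold>\<and> \<beta>)" "code \<beta> < code (\<alpha> \<^bold>\<and> \<beta>)"
  "code \<alpha> < code (\<alpha> \<^bold>\<or> \<beta>)" "code \<beta> < code (\<alpha> \<^bold>\<or> \<beta>)"
  "code \<alpha> < code (\<^bold>\<not> \<alpha>)"
  using le_prod_encode_1[of "code \<alpha>" "code \<beta>"] le_prod_encode_2[of "code \<beta>" "code \<alpha>"] by simp_all

lemma bqG_code_le: "bqG B \<alpha> \<beta> \<Longrightarrow> code \<alpha> \<le> B \<and> code \<beta> \<le> B"
proof (induction rule: bqG.induct)
  case (RES \<alpha> \<beta> \<gamma>)
  then show ?case using code_subformula_less(2)[of \<beta> \<alpha>] by linarith
next
  case (RES_inv \<beta> \<alpha> \<gamma>)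
  then show ?case using code_subformula_less(4)[of \<gamma> \<alpha>] by linarith
next
  case (MN \<alpha> \<gamma>)
  then show ?case using code_subformula_less(9)[of \<gamma>] by linarith
qed blast+

text \<open>Residuation gives monotonicity on the right, with a detour through
  \<open>\<alpha> \<setminus> (\<alpha> \<cdot> \<gamma>)\<close>, which therefore has to fit the
  bound too.\<close>

lemma bqG_fus_mono:
  assumes "bqG B \<beta> \<gamma>" "code (\<alpha> \<^bold>\<cdot> \<beta>) \<le> B" "code (\<alpha> \<^bold>\<setminus> (\<alpha> \<^bold>\<cdot> \<gamma>)) \<le> B"
  shows "bqG B (\<alpha> \<^bold>\<cdot> \<beta>) (\<alpha> \<^bold>\<cdot> \<gamma>)"
proof -
  have "code (\<alpha> \<^bold>\<cdot> \<gamma>) \<le> B"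
    using assms(3) code_subformula_less(4)[of "\<alpha> \<^bold>\<cdot> \<gamma>" \<alpha>] by linarith
  then have "bqG B \<gamma> (\<alpha> \<^bold>\<setminus> (\<alpha> \<^bold>\<cdot> \<gamma>))"
    using assms(3) by (intro bqG.RES bqG.Id)
  with assms(1) have "bqG B \<beta> (\<alpha> \<^bold>\<setminus> (\<alpha> \<^bold>\<cdot> \<gamma>))" by (rule bqG.Cut)
  then show ?thesis using assms(2) by (rule bqG.RES_inv)
qed

text \<open>Contraposition passes through \<open>\<not> \<not> \<beta>\<close>, which
  \<open>MN\<close> derives from \<open>\<beta>\<close>; this is why the double negation is
  bounded.\<close>

lemma bqG_neg_antimono:
  assumes "bqG B \<alpha> \<beta>" "code (\<^bold>\<not> \<alpha>) \<le> B" "code (\<^bold>\<not> \<^bold>\<not> \<beta>) \<le> B"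
  shows "bqG B (\<^bold>\<not> \<beta>) (\<^bold>\<not> \<alpha>)"
proof -
  have "code (\<^bold>\<not> \<beta>) \<le> B"
    using assms(3) code_subformula_less(9)[of "\<^bold>\<not> \<beta>"] by linarith
  then have "bqG B \<beta> (\<^bold>\<not> \<^bold>\<not> \<beta>)"
    using assms(3) by (rule bqG.MN[OF bqG.Id])
  with assms(1) have "bqG B \<alpha> (\<^bold>\<not> \<^bold>\<not> \<beta>)" by (rule bqG.Cut)
  then show ?thesis using assms(2) by (rule bqG.MN)
qed

text \<open>The rule \<open>neg\<close> carries the left factor across the sequent, where
  contraposition can replace it, and then carries the new one back.\<close>

lemma bqG_fus_antimono_neg:
  assumes "bqG B (\<alpha> \<^bold>\<cdot> \<beta>) (\<^bold>\<not> \<gamma>)" "bqG B \<delta> \<alpha>"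
    and "code (\<gamma> \<^bold>\<cdot> \<beta>) \<le> B" "code (\<delta> \<^bold>\<cdot> \<beta>) \<le> B" "code (\<^bold>\<not> \<delta>) \<le> B" "code (\<^bold>\<not> \<^bold>\<not> \<alpha>) \<le> B"
  shows "bqG B (\<delta> \<^bold>\<cdot> \<beta>) (\<^bold>\<not> \<gamma>)"
proof -
  have "code (\<^bold>\<not> \<alpha>) \<le> B"
    using assms(6) code_subformula_less(9)[of "\<^bold>\<not> \<alpha>"] by linarith
  then have "bqG B (\<gamma> \<^bold>\<cdot> \<beta>) (\<^bold>\<not> \<alpha>)" by (rule bqG.neg[OF assms(1,3)])
  then have "bqG B (\<gamma> \<^bold>\<cdot> \<beta>) (\<^bold>\<not> \<delta>)"
    using bqG_neg_antimono[OF assms(2,5,6)] by (rule bqG.Cut)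
  then show ?thesis using bqG_code_le[OF assms(1)] by (intro bqG.neg[OF _ assms(4)]) auto
qed

section \<open>A graded model\<close>

text \<open>Dominates one application of \<open>\<cdot>\<close>, \<open>\<setminus>\<close> or
  \<open>\<not>\<close> to formulas with codes up to \<open>n\<close>: 5 is the largest connective
  tag.\<close>

definition code_bound :: "nat \<Rightarrow> nat" where
  "code_bound n = 6 * prod_encode (n, n) + 5"

lemma prod_encode_mono: "a \<le> a' \<Longrightarrow> b \<le> b' \<Longrightarrow> prod_encode (a, b) \<le> prod_encode (a', b')"
proof -
  have "triangle m \<le> triangle n" if "m \<le> n" for m n
    using that by (induction n) (auto simp: le_Suc_eq)
  then show "a \<le> a' \<Longrightarrow> b \<le> b' \<Longrightarrow> ?thesis"
    by (simp add: prod_encode_def add_le_mono)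
qed

lemma code_le_code_bound:
  assumes "code \<alpha> \<le> n" "code \<beta> \<le> n"
  shows "code (\<alpha> \<^bold>\<cdot> \<beta>) \<le> code_bound n" "code (\<alpha> \<^bold>\<setminus> \<beta>) \<le> code_bound n" "code (\<^bold>\<not> \<alpha>) \<le> code_bound n"
  using prod_encode_mono[OF assms] le_prod_encode_1[of n n] assms(1) by (simp_all add: code_bound_def)

lemma le_code_bound: "n \<le> code_bound n"
  using le_prod_encode_1[of n n] by (simp add: code_bound_def)

locale grading =
  fixes N :: nat
begin

text \<open>One level per connective, starting from the codes up to \<open>N\<close>.\<close>

definition lev :: "nat \<Rightarrow> nat" where
  "lev k = (code_bound ^^ k) N"

lemma lev_mono: "k \<le> l \<Longrightarrow> lev k \<le> lev l"
proof (induction l)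
  case (Suc l)
  then show ?case
    using le_code_bound[of "lev l"] by (auto simp: lev_def le_Suc_eq)
qed simp

lemma code_le_lev:
  assumes "code \<alpha> \<le> lev k" "code \<beta> \<le> lev l" "k < n" "l < n"
  shows "code (\<alpha> \<^bold>\<cdot> \<beta>) \<le> lev n" "code (\<alpha> \<^bold>\<setminus> \<beta>) \<le> lev n" "code (\<^bold>\<not> \<alpha>) \<le> lev n"
proof -
  obtain n' where n: "n = Suc n'" using assms(3) by (cases n) auto
  have "code \<alpha> \<le> lev n'" "code \<beta> \<le> lev n'"
    using assms lev_mono[of k n'] lev_mono[of l n'] n by auto
  from code_le_code_bound[OF this]
  show "code (\<alpha> \<^bold>\<cdot> \<beta>) \<le> lev n" "code (\<alpha> \<^bold>\<setminus> \<beta>) \<le> lev n" "code (\<^bold>\<not> \<alpha>) \<le> lev n"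
    by (simp_all add: n lev_def)
qed

section \<open>The grid of grades\<close>

definition height :: nat where "height = (N + 1) * (N + 1)"

text \<open>Lies above all tests, whose levels end at \<open>height + 1 + N\<close>, and above the
  auxiliary formulas of the derived rules applied to elements.\<close>

abbreviation bnd :: nat where "bnd \<equiv> lev (height + N + 4)"

abbreviation D :: "form \<Rightarrow> form \<Rightarrow> bool" where "D \<equiv> bqG bnd"

text \<open>Row-major numbering: row \<open>i + 1\<close> outranks all of row \<open>i\<close>. Thus
  in a fusion the right argument may come from any column of the row below, and only the label must
  lie further left.\<close>

definition rk :: "nat \<Rightarrow> nat \<Rightarrow> nat" where "rk i j = i * (N + 1) + j"

definition elems :: "nat \<Rightarrow> nat \<Rightarrow> form set" where
  "elems i j = {x. code x \<le> lev (rk i j)}"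

text \<open>The offset 1 above \<open>height\<close> makes the negation of every element on the grid
  a test. Levels decrease with \<open>i\<close>, leaving room in row \<open>i\<close> for residuals
  of tests of row \<open>i + 1\<close>.\<close>

definition tests :: "nat \<Rightarrow> form set" where
  "tests i = {z. code z \<le> lev (height + 1 + (N - i))}"

text \<open>The double polar of \<open>X\<close> for the relation \<open>D\<close> between elements
  and tests, as in a Dedekind-MacNeille completion.\<close>

definition cl :: "nat \<Rightarrow> nat \<Rightarrow> form set \<Rightarrow> form set" where
  "cl i j X = {x \<in> elems i j. \<forall>z \<in> tests i. (\<forall>y \<in> X. D y z) \<longrightarrow> D x z}"

text \<open>Fusion is not monotone in its left argument, so a fusion \<open>\<alpha> \<cdot> y\<close> has to keep the literal label \<open>\<alpha>\<close>
  wherever \<open>\<alpha>\<close> generates its own value. Below a negation it does not matter which elements of the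
  value are used as labels.\<close>

definition gens :: "form \<Rightarrow> form set \<Rightarrow> form set" where
  "gens \<alpha> X = (if \<alpha> \<in> X \<and> (\<forall>x \<in> X. D x \<alpha>) then {\<alpha>} else X)"

text \<open>Fusion maps grade \<open>(i, j)\<close> or \<open>(i, N - 1 - j)\<close>, with a label from \<open>(i + 1, j)\<close>, to
  \<open>(i + 1, j + 1)\<close>. Negation pairs column \<open>j\<close> with column \<open>N - j\<close>, which makes the rule \<open>neg\<close>
  exchange the label columns \<open>j\<close> and \<open>N - 1 - j\<close>. The target of a fusion has larger \<open>rk\<close> than
  its arguments, so the elements at each grade have bounded codes.\<close>

primrec V :: "form \<Rightarrow> nat \<Rightarrow> nat \<Rightarrow> form set" where
  "V (Var n) i j = cl i j {x \<in> elems i j. D x (Var n)}"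
| "V (\<alpha> \<^bold>\<cdot> \<beta>) i j = cl i j {g \<^bold>\<cdot> y | g y i' j'. i = Suc i' \<and> j = Suc j' \<and>
      g \<in> gens \<alpha> (V \<alpha> i j') \<and> y \<in> V \<beta> i' j' \<union> V \<beta> i' (N - Suc j')}"
| "V (\<alpha> \<^bold>\<setminus> \<gamma>) i j = {y \<in> elems i j. i < N \<and> j < N \<longrightarrow>
      (\<forall>g \<in> gens \<alpha> (V \<alpha> (Suc i) j). g \<^bold>\<cdot> y \<in> V \<gamma> (Suc i) (Suc j)) \<and>
      (\<forall>g \<in> gens \<alpha> (V \<alpha> (Suc i) (N - Suc j)). g \<^bold>\<cdot> y \<in> V \<gamma> (Suc i) (N - j))}"
| "V (\<alpha> \<^bold>\<and> \<beta>) i j = V \<alpha> i j \<inter> V \<beta> i j"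
| "V (\<alpha> \<^bold>\<or> \<beta>) i j = cl i j (V \<alpha> i j \<union> V \<beta> i j)"
| "V (\<^bold>\<not> \<gamma>) i j = {x \<in> elems i j. \<forall>c \<in> V \<gamma> i (N - j). D x (\<^bold>\<not> c)}"

section \<open>Closure of the values\<close>

lemma rk_less_height: "i \<le> N \<Longrightarrow> j \<le> N \<Longrightarrow> rk i j < height"
proof -
  assume "i \<le> N" "j \<le> N"
  then have "i * (N + 1) + j < N * (N + 1) + (N + 1)"
    by (intro add_le_less_mono mult_le_mono1) auto
  then show ?thesis by (simp add: rk_def height_def algebra_simps)
qed

lemma elems_le_bnd:
  assumes "x \<in> elems i j" "i \<le> N" "j \<le> N"
  shows "code x \<le> lev height" "code x \<le> bnd"
  using assms lev_mono[of "rk i j" height] lev_mono[of "rk i j" "height + N + 4"] rk_less_height[of i j]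
  by (auto simp: elems_def)

lemma elems_bounds:
  assumes "code x \<le> lev height" "code y \<le> lev height"
  shows "code (x \<^bold>\<cdot> y) \<le> bnd" "code (\<^bold>\<not> x) \<le> bnd" "code (\<^bold>\<not> \<^bold>\<not> x) \<le> bnd"
    "code (x \<^bold>\<setminus> (x \<^bold>\<cdot> y)) \<le> bnd"
  using code_le_lev[OF assms(1,2), of "height + N + 4"]
    code_le_lev[OF assms(1) code_le_lev(1)[OF assms(1,2), of "height + 1"], of "height + N + 4"]
    code_le_lev(3)[OF code_le_lev(3)[OF assms(1,2), of "height + 1"] assms(2), of "height + N + 4"]
  by auto

lemma fus_in_elems:
  assumes "g \<in> elems (Suc i) j" "y \<in> elems i j'" "j' \<le> N"
  shows "g \<^bold>\<cdot> y \<in> elems (Suc i) (Suc j)"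
proof -
  have "rk i j' < rk (Suc i) (Suc j)" "rk (Suc i) j < rk (Suc i) (Suc j)"
    using assms(3) by (auto simp: rk_def)
  then show ?thesis using assms code_le_lev(1) by (auto simp: elems_def)
qed

lemma cl_subset_elems: "cl i j X \<subseteq> elems i j"
  by (auto simp: cl_def)

lemma subset_cl: "X \<subseteq> elems i j \<Longrightarrow> X \<subseteq> cl i j X"
  by (auto simp: cl_def)

lemma cl_mono: "X \<subseteq> Y \<Longrightarrow> cl i j X \<subseteq> cl i j Y"
  by (auto simp: cl_def)

lemma cl_idem: "cl i j (cl i j X) \<subseteq> cl i j X"
  by (auto simp: cl_def)

lemma cl_least: "X \<subseteq> Y \<Longrightarrow> cl i j Y \<subseteq> Y \<Longrightarrow> cl i j X \<subseteq> Y"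
  using cl_mono[of X Y] by blast

lemma V_subset_elems: "V \<phi> i j \<subseteq> elems i j"
  by (induction \<phi>) (use cl_subset_elems in auto)

lemma V_in_elems: "x \<in> V \<phi> i j \<Longrightarrow> x \<in> elems i j"
  using V_subset_elems by blast

lemma V_code_le: "x \<in> V \<phi> i j \<Longrightarrow> i \<le> N \<Longrightarrow> j \<le> N \<Longrightarrow> code x \<le> lev height"
  by (rule elems_le_bnd(1)[OF V_in_elems])

lemma V_fus_subset:
  assumes "cl i j Y \<subseteq> Y"
    and "\<And>i' j' g y. i = Suc i' \<Longrightarrow> j = Suc j' \<Longrightarrow> g \<in> gens \<alpha> (V \<alpha> i j') \<Longrightarrow>
      y \<in> V \<beta> i' j' \<union> V \<beta> i' (N - Suc j') \<Longrightarrow> g \<^bold>\<cdot> y \<in> Y"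
  shows "V (\<alpha> \<^bold>\<cdot> \<beta>) i j \<subseteq> Y"
proof -
  have "{g \<^bold>\<cdot> y | g y i' j'. i = Suc i' \<and> j = Suc j' \<and>
      g \<in> gens \<alpha> (V \<alpha> i j') \<and> y \<in> V \<beta> i' j' \<union> V \<beta> i' (N - Suc j')} \<subseteq> Y"
    using assms(2) by blast
  from cl_least[OF this assms(1)] show ?thesis by simp
qed

lemma gens_subset: "gens \<alpha> X \<subseteq> X"
  by (auto simp: gens_def)

lemma gens_in_elems: "g \<in> gens \<alpha> (V \<alpha> i j) \<Longrightarrow> g \<in> elems i j"
  using gens_subset V_subset_elems by blast

text \<open>The residual condition on \<open>y\<close> is an intersection of tests \<open>g \<setminus> z\<close> because the tests at level
  \<open>i\<close> contain all \<open>g \<setminus> z\<close> for elements \<open>g\<close> and tests \<open>z\<close> of level \<open>i + 1\<close>.\<close>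

lemma closed_residual:
  assumes "y \<in> cl i j Y" "i < N" "j' < N" "j \<le> N" "g \<in> elems (Suc i) j'"
    and "cl (Suc i) (Suc j') X \<subseteq> X" "\<And>y'. y' \<in> Y \<Longrightarrow> y' \<in> elems i j \<and> g \<^bold>\<cdot> y' \<in> X"
  shows "g \<^bold>\<cdot> y \<in> X"
proof -
  have y: "y \<in> elems i j" using assms(1) cl_subset_elems by blast
  have gy: "g \<^bold>\<cdot> y \<in> elems (Suc i) (Suc j')" by (rule fus_in_elems[OF assms(5) y assms(4)])
  have g: "code g \<le> lev height" using elems_le_bnd[OF assms(5)] assms(2,3) by auto
  have "D (g \<^bold>\<cdot> y) z" if z: "z \<in> tests (Suc i)" and Xz: "\<forall>x\<in>X. D x z" for z
  proof -
    have "code z \<le> lev (height + 1 + (N - Suc i))" using z by (simp add: tests_def)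
    then have gz: "code (g \<^bold>\<setminus> z) \<le> lev (height + 1 + (N - i))"
      using code_le_lev(2)[OF g, of z] assms(2) by simp
    then have gzt: "g \<^bold>\<setminus> z \<in> tests i" by (simp add: tests_def)
    have gzb: "code (g \<^bold>\<setminus> z) \<le> bnd"
      using gz lev_mono[of "height + 1 + (N - i)" "height + N + 4"] by linarith
    have "\<forall>y'\<in>Y. D y' (g \<^bold>\<setminus> z)"
      using Xz assms(7) gzb by (auto intro: bqG.RES)
    then have "D y (g \<^bold>\<setminus> z)" using assms(1) gzt by (auto simp: cl_def)
    then show ?thesis
      using elems_le_bnd(2)[OF gy] assms(2,3) by (auto intro: bqG.RES_inv)
  qed
  then have "g \<^bold>\<cdot> y \<in> cl (Suc i) (Suc j') X" using gy by (auto simp: cl_def)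
  then show ?thesis using assms(6) by blast
qed

text \<open>Variables, fusions and disjunctions are closures by definition, conjunctions are
  intersections, and the conditions defining residuals and negations can be expressed by
  tests.\<close>

lemma V_closed: "i \<le> N \<Longrightarrow> j \<le> N \<Longrightarrow> cl i j (V \<phi> i j) \<subseteq> V \<phi> i j"
proof (induction \<phi> arbitrary: i j)
  case (Res \<alpha> \<gamma>)
  show ?case
  proof
    fix y assume y: "y \<in> cl i j (V (\<alpha> \<^bold>\<setminus> \<gamma>) i j)"
    have "g \<^bold>\<cdot> y \<in> V \<gamma> (Suc i) (Suc j)"
      if "i < N" "j < N" "g \<in> gens \<alpha> (V \<alpha> (Suc i) j)" for g
      by (rule closed_residual[OF y that(1,2) _ gens_in_elems[OF that(3)]])
         (use that Res in auto)
    moreover have "g \<^bold>\<cdot> y \<in> V \<gamma> (Suc i) (N - j)"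
      if "i < N" "j < N" "g \<in> gens \<alpha> (V \<alpha> (Suc i) (N - Suc j))" for g
    proof -
      \<comment> \<open>The mirrored condition has label column \<open>N - Suc j\<close> and target
        column \<open>N - j\<close>, again its successor, so the same closure argument
        applies.\<close>
      have N: "N - j = Suc (N - Suc j)" using that by simp
      show ?thesis unfolding N
        by (rule closed_residual[OF y that(1) _ _ gens_in_elems[OF that(3)]])
           (use that Res N in auto)
    qed
    ultimately show "y \<in> V (\<alpha> \<^bold>\<setminus> \<gamma>) i j"
      using subsetD[OF cl_subset_elems y] by auto
  qed
next
  case (Con \<alpha> \<beta>)
  have "cl i j (V (\<alpha> \<^bold>\<and> \<beta>) i j) \<subseteq> cl i j (V \<alpha> i j)"
    "cl i j (V (\<alpha> \<^bold>\<and> \<beta>) i j) \<subseteq> cl i j (V \<beta> i j)" by (auto intro!: cl_mono)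
  then show ?case using Con.IH[OF Con.prems] by auto
next
  case (Neg \<gamma>)
  show ?case
  proof
    fix x assume x: "x \<in> cl i j (V (\<^bold>\<not> \<gamma>) i j)"
    have "D x (\<^bold>\<not> c)" if c: "c \<in> V \<gamma> i (N - j)" for c
    proof -
      have "code c \<le> lev height"
        using V_code_le[OF c] Neg.prems by simp
      then have "\<^bold>\<not> c \<in> tests i"
        using code_le_lev(3)[of c height c height] by (simp add: tests_def)
      then show ?thesis using x c by (auto simp: cl_def)
    qed
    then show "x \<in> V (\<^bold>\<not> \<gamma>) i j" using subsetD[OF cl_subset_elems x] by auto
  qed
qed (use cl_idem in auto)

section \<open>Soundness of the rules\<close>

text \<open>If \<open>gens\<close> has collapsed to the single label \<open>\<alpha>\<close>, every
  \<open>a\<close> in \<open>X\<close> derives \<open>\<alpha>\<close>, and below a negation the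
  label may be replaced by such an \<open>a\<close>.\<close>

lemma bqG_gens:
  assumes "\<forall>g \<in> gens \<alpha> X. D (g \<^bold>\<cdot> y) (\<^bold>\<not> c)" "a \<in> X"
    and "\<And>x. x \<in> X \<Longrightarrow> code x \<le> lev height" "code y \<le> lev height" "code c \<le> lev height"
  shows "D (a \<^bold>\<cdot> y) (\<^bold>\<not> c)"
proof (cases "gens \<alpha> X = X")
  case False
  then have "\<alpha> \<in> X" "D a \<alpha>" "D (\<alpha> \<^bold>\<cdot> y) (\<^bold>\<not> c)"
    using assms(1,2) by (auto simp: gens_def split: if_splits)
  then show ?thesis
    using assms(2-) elems_bounds by (intro bqG_fus_antimono_neg[of _ \<alpha> y c a]) auto
qed (use assms in auto)

text \<open>A closure contains its generators only if they are elements of the grade; the comparison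
  of ranks ensures this.\<close>

lemma gen_fus_in_V:
  assumes "g \<in> gens \<alpha> (V \<alpha> (Suc i) j)" "y \<in> V \<beta> i j \<union> V \<beta> i (N - Suc j)" "i < N" "j < N"
  shows "g \<^bold>\<cdot> y \<in> V (\<alpha> \<^bold>\<cdot> \<beta>) (Suc i) (Suc j)"
proof -
  let ?X = "{g \<^bold>\<cdot> y | g y i' j'. Suc i = Suc i' \<and> Suc j = Suc j' \<and>
      g \<in> gens \<alpha> (V \<alpha> (Suc i) j') \<and> y \<in> V \<beta> i' j' \<union> V \<beta> i' (N - Suc j')}"
  have "?X \<subseteq> elems (Suc i) (Suc j)"
  proof
    fix x assume "x \<in> ?X"
    then obtain g y where x: "x = g \<^bold>\<cdot> y" "g \<in> gens \<alpha> (V \<alpha> (Suc i) j)"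
      "y \<in> V \<beta> i j \<union> V \<beta> i (N - Suc j)" by auto
    have "y \<in> elems i j \<or> y \<in> elems i (N - Suc j)" using x(3) V_in_elems by blast
    then obtain j' where "y \<in> elems i j'" "j' \<le> N"
      using assms(4) that[of j] that[of "N - Suc j"] by auto
    then show "x \<in> elems (Suc i) (Suc j)"
      unfolding x(1) by (rule fus_in_elems[OF gens_in_elems[OF x(2)]])
  qed
  moreover have "g \<^bold>\<cdot> y \<in> ?X" using assms by blast
  ultimately show ?thesis unfolding V.simps by (rule subsetD[OF subset_cl])
qed

text \<open>The two conjuncts in the value of a residual match the two columns from which a fusion
  takes right arguments; this gives both residuation rules. The mirror symmetry of the columns gives
  \<open>neg\<close> and \<open>MN\<close>.\<close>

theorem V_sound:
  "\<turnstile> \<alpha> \<^bold>\<Rightarrow> \<beta> \<Longrightarrow> i \<le> N \<Longrightarrow> j \<le> N \<Longrightarrow> V \<alpha> i j \<subseteq> V \<beta> i j"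
proof (induction arbitrary: i j rule: qG.induct)
  case (RES \<alpha> \<beta> \<gamma>)
  show ?case
  proof
    fix y assume y: "y \<in> V \<beta> i j"
    have "g \<^bold>\<cdot> y \<in> V \<gamma> (Suc i) (Suc j)"
      if "i < N" "j < N" "g \<in> gens \<alpha> (V \<alpha> (Suc i) j)" for g
      using gen_fus_in_V[OF that(3) _ that(1,2), of y \<beta>] y RES.IH[of "Suc i" "Suc j"] that by auto
    moreover have "g \<^bold>\<cdot> y \<in> V \<gamma> (Suc i) (N - j)"
      if "i < N" "j < N" "g \<in> gens \<alpha> (V \<alpha> (Suc i) (N - Suc j))" for g
    proof -
      \<comment> \<open>Seen from label column \<open>N - Suc j\<close>, the column \<open>j\<close>
        of \<open>y\<close> is the mirrored one, so \<open>g \<cdot> y\<close> is again a generator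
        of the fusion.\<close>
      have N: "N - j = Suc (N - Suc j)" "N - Suc (N - Suc j) = j" using that by simp_all
      show ?thesis
        unfolding N(1)
        by (rule subsetD[OF RES.IH gen_fus_in_V[OF that(3) _ that(1)]]) (use y that N(2) in auto)
    qed
    ultimately show "y \<in> V (\<alpha> \<^bold>\<setminus> \<gamma>) i j" using V_in_elems[OF y] by auto
  qed
next
  case (RES_inv \<beta> \<alpha> \<gamma>)
  show ?case
  proof (rule V_fus_subset[OF V_closed[OF RES_inv.prems]])
    fix i' j' g y
    assume a: "i = Suc i'" "j = Suc j'" "g \<in> gens \<alpha> (V \<alpha> i j')" "y \<in> V \<beta> i' j' \<union> V \<beta> i' (N - Suc j')"
    have N: "N - (N - Suc j') = j" "N - Suc (N - Suc j') = j'"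
      using a RES_inv.prems by simp_all
    from a(4) show "g \<^bold>\<cdot> y \<in> V \<gamma> i j"
    proof
      assume "y \<in> V \<beta> i' j'"
      then have "y \<in> V (\<alpha> \<^bold>\<setminus> \<gamma>) i' j'" using RES_inv.IH[of i' j'] RES_inv.prems a by auto
      then show ?thesis using a RES_inv.prems by auto
    next
      \<comment> \<open>Here the second conjunct of the residual is used: at column
        \<open>N - Suc j'\<close> its labels come from column \<open>j'\<close> and its target is
        column \<open>j\<close>.\<close>
      assume "y \<in> V \<beta> i' (N - Suc j')"
      then have "y \<in> V (\<alpha> \<^bold>\<setminus> \<gamma>) i' (N - Suc j')"
        using RES_inv.IH[of i' "N - Suc j'"] RES_inv.prems a by auto
      then show ?thesis using a RES_inv.prems by (auto simp: N)
    qed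
  qed
next
  case (disL \<alpha> \<beta> \<gamma>)
  show ?case unfolding V.simps
    by (rule cl_least[OF _ V_closed[OF disL.prems]]) (use disL in auto)
next
  case (disR1 \<alpha> \<beta> \<gamma>)
  have "V \<beta> i j \<union> V \<gamma> i j \<subseteq> V (\<beta> \<^bold>\<or> \<gamma>) i j"
    unfolding V.simps by (intro subset_cl Un_least V_subset_elems)
  then show ?case using disR1.IH[OF disR1.prems] by blast
next
  case (disR2 \<alpha> \<beta> \<gamma>)
  have "V \<gamma> i j \<union> V \<beta> i j \<subseteq> V (\<gamma> \<^bold>\<or> \<beta>) i j"
    unfolding V.simps by (intro subset_cl Un_least V_subset_elems)
  then show ?case using disR2.IH[OF disR2.prems] by blast
next
  case (neg \<alpha> \<beta> \<gamma>)
  show ?case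
  proof (rule V_fus_subset[OF V_closed[OF neg.prems]])
    fix i' j' g y
    assume a: "i = Suc i'" "j = Suc j'" "g \<in> gens \<gamma> (V \<gamma> i j')" "y \<in> V \<beta> i' j' \<union> V \<beta> i' (N - Suc j')"
    \<comment> \<open>Mirroring exchanges \<open>j'\<close> and \<open>?k\<close>, the two possible
      columns of \<open>y\<close>; hence \<open>y\<close> is also an admissible right argument for
      labels of \<open>\<alpha>\<close> from column \<open>?k\<close>.\<close>
    let ?k = "N - Suc j'"
    have N: "N - j = ?k" "Suc ?k = N - j'" "N - Suc ?k = j'" "N - (N - j') = j'" "i' < N" "?k < N"
      using a(1,2) neg.prems by auto
    have y: "code y \<le> lev height" using a(1,2,4) V_code_le[of y] neg.prems by auto
    have "y \<in> elems i' j' \<or> y \<in> elems i' ?k" using a(4) V_in_elems by blast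
    then have gy: "g \<^bold>\<cdot> y \<in> elems i j"
      using fus_in_elems[of g i' j' y] gens_in_elems[OF a(3)] neg.prems unfolding a(1,2) by auto
    have g: "g \<in> V \<gamma> i j'" using a gens_subset by blast
    then have gc: "code g \<le> lev height" using V_code_le a(2) neg.prems by simp
    \<comment> \<open>By \<open>neg\<close> it suffices that \<open>a \<cdot> y\<close> derives
      \<open>\<not> g\<close>, and by \<open>bqG_gens\<close> only generating labels
      \<open>h\<close> need checking; for these the induction hypothesis applies.\<close>
    have "D (g \<^bold>\<cdot> y) (\<^bold>\<not> a)" if "a \<in> V \<alpha> i ?k" for a
    proof -
      have "\<forall>h \<in> gens \<alpha> (V \<alpha> i ?k). D (h \<^bold>\<cdot> y) (\<^bold>\<not> g)"
      proof
        fix h assume h: "h \<in> gens \<alpha> (V \<alpha> i ?k)"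
        have "h \<^bold>\<cdot> y \<in> V (\<alpha> \<^bold>\<cdot> \<beta>) i (Suc ?k)"
          unfolding a(1) by (rule gen_fus_in_V) (use h a N in auto)
        then have "h \<^bold>\<cdot> y \<in> V (\<^bold>\<not> \<gamma>) i (Suc ?k)"
          using neg.IH[of i "Suc ?k"] neg.prems N by auto
        then show "D (h \<^bold>\<cdot> y) (\<^bold>\<not> g)" using g N by auto
      qed
      then have "D (a \<^bold>\<cdot> y) (\<^bold>\<not> g)"
        by (rule bqG_gens[OF _ that]) (use V_code_le neg.prems y gc in auto)
      moreover have "code a \<le> lev height" using V_code_le[OF that] neg.prems by simp
      ultimately show ?thesis using elems_bounds y gc by (intro bqG.neg[of _ a y g])
    qed
    then show "g \<^bold>\<cdot> y \<in> V (\<^bold>\<not> \<alpha>) i j" using gy N by auto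
  qed
next
  case (MN \<alpha> \<gamma>)
  show ?case
  proof
    fix c assume c: "c \<in> V \<gamma> i j"
    have "D c (\<^bold>\<not> a)" if "a \<in> V \<alpha> i (N - j)" for a
    proof -
      have "a \<in> V (\<^bold>\<not> \<gamma>) i (N - j)" using MN.IH[of i "N - j"] MN.prems that by auto
      then have "D a (\<^bold>\<not> c)" using c MN.prems by simp
      moreover have "code a \<le> lev height" using V_code_le[OF that] MN.prems by simp
      ultimately show ?thesis using elems_bounds(2) by (intro bqG.MN[of _ a c])
    qed
    then show "c \<in> V (\<^bold>\<not> \<alpha>) i j" using V_in_elems[OF c] by auto
  qed
next
  case (Cut \<alpha> \<beta> \<gamma>)
  then show ?case by (meson order.trans)
qed auto

text \<open>Formulas are represented faithfully only away from the border of the grid, at a distance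
  at least their code.\<close>

definition depth :: "nat \<Rightarrow> nat \<Rightarrow> nat" where
  "depth i j = min (min i (N - i)) (min j (N - j))"

section \<open>Representation of small formulas\<close>

lemma small_in_elems: "code \<phi> \<le> N \<Longrightarrow> \<phi> \<in> elems i j"
  using lev_mono[of 0 "rk i j"] by (simp add: elems_def lev_def)

lemma small_in_tests: "code \<phi> \<le> N \<Longrightarrow> \<phi> \<in> tests i"
  using lev_mono[of 0 "height + 1 + (N - i)"] by (simp add: tests_def lev_def)

lemma small_le_height: "code \<phi> \<le> N \<Longrightarrow> code \<phi> \<le> lev height"
  using lev_mono[of 0 height] by (simp add: lev_def)

lemma small_le_bnd: "code \<phi> \<le> N \<Longrightarrow> code \<phi> \<le> bnd"
  using lev_mono[of 0 "height + N + 4"] by (simp add: lev_def)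

lemma depth_le: "i \<le> N \<Longrightarrow> depth i j \<le> N"
  by (auto simp: depth_def)

text \<open>A move to a neighbouring grade costs at most one unit of depth, while passing to a
  proper subformula lowers the code by at least one.\<close>

lemma depth_step:
  assumes "k < depth i j" "i \<le> Suc i'" "i' \<le> Suc i" "j \<le> Suc j'" "j' \<le> Suc j"
  shows "k \<le> depth i' j'"
proof -
  have "k < i" "k < N - i" "k < j" "k < N - j" using assms(1) by (simp_all add: depth_def)
  then have "k \<le> i'" "k \<le> N - i'" "k \<le> j'" "k \<le> N - j'" using assms(2-) by linarith+
  then show ?thesis by (simp add: depth_def)
qed

lemma depth_flip: "j \<le> N \<Longrightarrow> depth i (N - j) = depth i j"
  by (simp add: depth_def min.commute)

text \<open>By \<open>Cut\<close>, \<open>x\<close> satisfies every test that \<open>y\<close>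
  satisfies.\<close>

lemma V_closedD:
  assumes "y \<in> V \<phi> i j" "D x y" "x \<in> elems i j" "i \<le> N" "j \<le> N"
  shows "x \<in> V \<phi> i j"
proof -
  have "x \<in> cl i j (V \<phi> i j)" using assms by (auto simp: cl_def intro: bqG.Cut)
  then show ?thesis using V_closed assms by blast
qed

lemma cl_D: "x \<in> cl i j X \<Longrightarrow> (\<And>y. y \<in> X \<Longrightarrow> D y z) \<Longrightarrow> z \<in> tests i \<Longrightarrow> D x z"
  by (auto simp: cl_def)

text \<open>Membership and the upper bound are proved together because both are needed to collapse
  \<open>gens\<close> to the literal label in fusions and residuals.\<close>

theorem V_represents:
  "i \<le> N \<Longrightarrow> j \<le> N \<Longrightarrow> code \<phi> \<le> depth i j \<Longrightarrow> \<phi> \<in> V \<phi> i j \<and> (\<forall>x \<in> V \<phi> i j. D x \<phi>)"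
proof (induction \<phi> arbitrary: i j)
  case (Var n)
  then have small: "code (Var n) \<le> N" using depth_le order.trans by blast
  then have "Var n \<in> {x \<in> elems i j. D x (Var n)}"
    using small_in_elems small_le_bnd by (auto intro!: bqG.Id simp del: code.simps)
  moreover have "D x (Var n)" if "x \<in> V (Var n) i j" for x
    by (rule cl_D[OF that[unfolded V.simps] _ small_in_tests[OF small]]) simp
  ultimately show ?case
    using subset_cl[of "{x \<in> elems i j. D x (Var n)}" i j] by auto
next
  case (Fus \<alpha> \<beta>)
  have small: "code (\<alpha> \<^bold>\<cdot> \<beta>) \<le> N" using Fus.prems depth_le order.trans by blast
  \<comment> \<open>The code of a fusion is positive, so the grade is off the border, where a fusion
    would have no generators.\<close>
  have "0 < depth i j" using Fus.prems by simp
  then obtain i' j' where ij: "i = Suc i'" "j = Suc j'"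
    by (cases i; cases j) (auto simp: depth_def)
  have le: "code \<alpha> < depth i j" "code \<beta> < depth i j"
    using Fus.prems(3) code_subformula_less(1)[of \<alpha> \<beta>] code_subformula_less(2)[of \<beta> \<alpha>] by linarith+
  have "code \<alpha> \<le> depth i j'" "code \<beta> \<le> depth i' j'"
    using depth_step[OF le(1), of i j'] depth_step[OF le(2), of i' j'] ij by auto
  moreover have "code \<beta> \<le> depth i' (N - j)"
    using depth_step[OF le(2), of i' j] depth_flip Fus.prems(2) ij by auto
  ultimately have a: "\<alpha> \<in> V \<alpha> i j'" "\<forall>x \<in> V \<alpha> i j'. D x \<alpha>"
    and b: "\<beta> \<in> V \<beta> i' j'" "\<forall>x \<in> V \<beta> i' j' \<union> V \<beta> i' (N - j). D x \<beta>"
    using Fus.IH(1)[of i j'] Fus.IH(2)[of i' j'] Fus.IH(2)[of i' "N - j"] Fus.prems ij by auto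
  \<comment> \<open>With \<open>\<alpha>\<close> as the only label, monotonicity on the right
    suffices for the upper bound.\<close>
  have g: "gens \<alpha> (V \<alpha> i j') = {\<alpha>}" using a by (simp add: gens_def)
  have "\<alpha> \<^bold>\<cdot> \<beta> \<in> V (\<alpha> \<^bold>\<cdot> \<beta>) i j"
    unfolding ij by (rule gen_fus_in_V) (use g b ij Fus.prems in auto)
  moreover have "V (\<alpha> \<^bold>\<cdot> \<beta>) i j \<subseteq> {x. D x (\<alpha> \<^bold>\<cdot> \<beta>)}"
  proof (rule V_fus_subset)
    show "cl i j {x. D x (\<alpha> \<^bold>\<cdot> \<beta>)} \<subseteq> {x. D x (\<alpha> \<^bold>\<cdot> \<beta>)}"
      using cl_D[OF _ _ small_in_tests[OF small]] by blast
  next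
    fix i'' j'' h y
    assume "i = Suc i''" "j = Suc j''" "h \<in> gens \<alpha> (V \<alpha> i j'')" "y \<in> V \<beta> i'' j'' \<union> V \<beta> i'' (N - Suc j'')"
    then have hy: "h = \<alpha>" "y \<in> V \<beta> i' j' \<union> V \<beta> i' (N - j)" using ij g by auto
    have "code \<alpha> \<le> N" "code \<beta> \<le> N" using le depth_le[OF Fus.prems(1)] by (meson less_imp_le order.trans)+
    then have "code \<alpha> \<le> lev height" "code \<beta> \<le> lev height" using small_le_height by auto
    moreover have "code y \<le> lev height" using hy V_code_le Fus.prems ij by auto
    ultimately have "D (\<alpha> \<^bold>\<cdot> y) (\<alpha> \<^bold>\<cdot> \<beta>)"
      using b hy(2) elems_bounds by (intro bqG_fus_mono) auto
    then show "h \<^bold>\<cdot> y \<in> {x. D x (\<alpha> \<^bold>\<cdot> \<beta>)}" by (simp add: hy(1))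
  qed
  ultimately show ?case by blast
next
  case (Res \<alpha> \<gamma>)
  have small: "code (\<alpha> \<^bold>\<setminus> \<gamma>) \<le> N" using Res.prems depth_le order.trans by blast
  \<comment> \<open>As for fusion; at \<open>i = N\<close> or \<open>j = N\<close> the condition on
    residuals would be vacuous.\<close>
  have "0 < depth i j" using Res.prems by simp
  then have ij: "i < N" "j < N" "0 < j" using Res.prems by (auto simp: depth_def)
  have le: "code \<alpha> < depth i j" "code \<gamma> < depth i j"
    using Res.prems(3) code_subformula_less(3)[of \<alpha> \<gamma>] code_subformula_less(4)[of \<gamma> \<alpha>] by linarith+
  have "code \<alpha> \<le> depth (Suc i) j" "code \<gamma> \<le> depth (Suc i) (Suc j)"
    using depth_step[OF le(1), of "Suc i" j] depth_step[OF le(2), of "Suc i" "Suc j"] by auto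
  moreover have "code \<alpha> \<le> depth (Suc i) (N - Suc j)" "code \<gamma> \<le> depth (Suc i) (N - j)"
    using depth_step[OF le(1), of "Suc i" "Suc j"] depth_step[OF le(2), of "Suc i" j] depth_flip ij
    by auto
  ultimately have ae: "\<alpha> \<in> V \<alpha> (Suc i) j" "\<alpha> \<in> V \<alpha> (Suc i) (N - Suc j)"
    and ad: "\<forall>x \<in> V \<alpha> (Suc i) j. D x \<alpha>" "\<forall>x \<in> V \<alpha> (Suc i) (N - Suc j). D x \<alpha>"
    and c: "\<gamma> \<in> V \<gamma> (Suc i) (Suc j)" "\<forall>x \<in> V \<gamma> (Suc i) (Suc j). D x \<gamma>" "\<gamma> \<in> V \<gamma> (Suc i) (N - j)"
    using Res.IH(1)[of "Suc i" j] Res.IH(1)[of "Suc i" "N - Suc j"]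
      Res.IH(2)[of "Suc i" "Suc j"] Res.IH(2)[of "Suc i" "N - j"] ij
    by (simp_all del: V.simps)
  then have a: "gens \<alpha> (V \<alpha> (Suc i) j) = {\<alpha>}" "gens \<alpha> (V \<alpha> (Suc i) (N - Suc j)) = {\<alpha>}"
    by (simp_all add: gens_def)
  have e: "\<alpha> \<^bold>\<setminus> \<gamma> \<in> elems i j" by (rule small_in_elems[OF small])
  have ce: "\<alpha> \<^bold>\<cdot> (\<alpha> \<^bold>\<setminus> \<gamma>) \<in> elems (Suc i) (Suc j)" "\<alpha> \<^bold>\<cdot> (\<alpha> \<^bold>\<setminus> \<gamma>) \<in> elems (Suc i) (Suc (N - Suc j))"
    using fus_in_elems[OF V_in_elems[OF ae(1)] e] fus_in_elems[OF V_in_elems[OF ae(2)] e] Res.prems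
    by auto
  have N: "Suc (N - Suc j) = N - j" using ij by simp
  \<comment> \<open>Modus ponens, which puts this fusion into both values of \<open>\<gamma>\<close>
    because they are closed downwards under \<open>D\<close> among elements.\<close>
  have "D (\<alpha> \<^bold>\<cdot> (\<alpha> \<^bold>\<setminus> \<gamma>)) \<gamma>"
    using elems_le_bnd(2)[OF ce(1)] ij small_le_bnd[OF small] by (intro bqG.RES_inv bqG.Id) auto
  then have "\<alpha> \<^bold>\<cdot> (\<alpha> \<^bold>\<setminus> \<gamma>) \<in> V \<gamma> (Suc i) (Suc j)" "\<alpha> \<^bold>\<cdot> (\<alpha> \<^bold>\<setminus> \<gamma>) \<in> V \<gamma> (Suc i) (N - j)"
    using V_closedD[OF c(1) _ ce(1)] V_closedD[OF c(3) _ ce(2)[unfolded N]] ij by auto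
  then have "\<alpha> \<^bold>\<setminus> \<gamma> \<in> V (\<alpha> \<^bold>\<setminus> \<gamma>) i j" using e a by simp
  moreover have "D x (\<alpha> \<^bold>\<setminus> \<gamma>)" if "x \<in> V (\<alpha> \<^bold>\<setminus> \<gamma>) i j" for x
    using that a c(2) ij small_le_bnd[OF small] by (auto intro!: bqG.RES simp del: code.simps)
  ultimately show ?case by blast
next
  case (Con \<alpha> \<beta>)
  have small: "code (\<alpha> \<^bold>\<and> \<beta>) \<le> N" using Con.prems depth_le order.trans by blast
  have le: "code \<alpha> \<le> depth i j" "code \<beta> \<le> depth i j"
    using Con.prems(3) code_subformula_less(5)[of \<alpha> \<beta>] code_subformula_less(6)[of \<beta> \<alpha>] by linarith+
  note IH = Con.IH(1)[OF Con.prems(1,2) le(1)] Con.IH(2)[OF Con.prems(1,2) le(2)]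
  have "code \<alpha> \<le> bnd" "code \<beta> \<le> bnd"
    using le depth_le[OF Con.prems(1)] small_le_bnd order.trans by blast+
  then have "D (\<alpha> \<^bold>\<and> \<beta>) \<alpha>" "D (\<alpha> \<^bold>\<and> \<beta>) \<beta>"
    using small_le_bnd[OF small] by (auto intro: bqG.Id bqG.conL1 bqG.conL2 simp del: code.simps)
  then have "\<alpha> \<^bold>\<and> \<beta> \<in> V (\<alpha> \<^bold>\<and> \<beta>) i j"
    using V_closedD[OF _ _ small_in_elems[OF small] Con.prems(1,2)] IH by auto
  then show ?case using IH small_le_bnd[OF small] by (auto intro: bqG.conR simp del: code.simps)
next
  case (Dis \<alpha> \<beta>)
  have small: "code (\<alpha> \<^bold>\<or> \<beta>) \<le> N" using Dis.prems depth_le order.trans by blast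
  have le: "code \<alpha> \<le> depth i j" "code \<beta> \<le> depth i j"
    using Dis.prems(3) code_subformula_less(7)[of \<alpha> \<beta>] code_subformula_less(8)[of \<beta> \<alpha>] by linarith+
  note IH = Dis.IH(1)[OF Dis.prems(1,2) le(1)] Dis.IH(2)[OF Dis.prems(1,2) le(2)]
  have "\<alpha> \<^bold>\<or> \<beta> \<in> V (\<alpha> \<^bold>\<or> \<beta>) i j"
    using IH small_in_elems[OF small] small_le_bnd[OF small]
    by (auto simp: cl_def intro!: bqG.disL simp del: code.simps)
  moreover have "D x (\<alpha> \<^bold>\<or> \<beta>)" if "x \<in> V (\<alpha> \<^bold>\<or> \<beta>) i j" for x
    by (rule cl_D[OF that[unfolded V.simps] _ small_in_tests[OF small]])
       (use IH small_le_bnd[OF small] in \<open>auto intro: bqG.disR1 bqG.disR2 simp del: code.simps\<close>)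
  ultimately show ?case by blast
next
  case (Neg \<gamma>)
  have small: "code (\<^bold>\<not> \<gamma>) \<le> N" using Neg.prems depth_le order.trans by blast
  have le: "code \<gamma> \<le> depth i (N - j)"
    using Neg.prems(2,3) code_subformula_less(9)[of \<gamma>] depth_flip by (simp del: code.simps)
  note IH = Neg.IH[OF Neg.prems(1) diff_le_self le]
  have "code \<gamma> \<le> lev height"
    using small_le_height[OF small] code_subformula_less(9)[of \<gamma>] by linarith
  then have "D (\<^bold>\<not> \<gamma>) (\<^bold>\<not> c)" if "c \<in> V \<gamma> i (N - j)" for c
    using that IH V_code_le[OF that Neg.prems(1)] elems_bounds(2,3) by (auto intro: bqG_neg_antimono)
  then show ?case using small_in_elems[OF small] IH by auto
qed

end

text \<open>At the midpoint of the grid \<open>\<alpha>\<close> lies in its own value, hence in that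
  of \<open>\<beta>\<close>, all of whose members derive \<open>\<beta>\<close> within the
  bound.\<close>

theorem qG_imp_bqG:
  assumes "\<turnstile> \<alpha> \<^bold>\<Rightarrow> \<beta>" "code \<alpha> \<le> m" "code \<beta> \<le> m" and N: "N = 2 * m"
  shows "bqG ((code_bound ^^ ((N + 1) * (N + 1) + N + 4)) N) \<alpha> \<beta>"
proof -
  interpret grading N .
  \<comment> \<open>The choice \<open>N = 2 * m\<close> gives the point \<open>(m, m)\<close>
    distance \<open>m\<close> from every side.\<close>
  have d: "m \<le> N" "depth m m = m" unfolding depth_def by (simp_all add: N)
  then have "\<alpha> \<in> V \<alpha> m m" "\<forall>x \<in> V \<beta> m m. D x \<beta>"
    using V_represents[of m m] assms(2,3) by auto
  then have "D \<alpha> \<beta>" using V_sound[OF assms(1) d(1) d(1)] by blast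
  then show ?thesis by (simp add: lev_def height_def)
qed

section \<open>Computable functions\<close>

definition computable :: "nat \<Rightarrow> (nat list \<Rightarrow> nat) \<Rightarrow> bool" where
  "computable n f \<longleftrightarrow> (\<exists>p. \<forall>xs. length xs = n \<longrightarrow> eval p xs (f xs))"

abbreviation decides :: "nat \<Rightarrow> (nat list \<Rightarrow> bool) \<Rightarrow> bool" where
  "decides n P \<equiv> computable n (\<lambda>xs. of_bool (P xs))"

lemma computable_cong:
  "(\<And>xs. length xs = n \<Longrightarrow> f xs = g xs) \<Longrightarrow> computable n f \<longleftrightarrow> computable n g"
  by (simp add: computable_def cong: imp_cong)

lemma computable_nth: "i < n \<Longrightarrow> computable n (\<lambda>xs. xs ! i)"
  unfolding computable_def by (metis eval.Proj)

lemma computable_comp: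
  assumes f: "computable (length gs) f" and gs: "\<And>g. g \<in> set gs \<Longrightarrow> computable n g"
  shows "computable n (\<lambda>xs. f (map (\<lambda>g. g xs) gs))"
proof -
  obtain p where p: "\<And>xs. length xs = length gs \<Longrightarrow> eval p xs (f xs)"
    using f by (auto simp: computable_def)
  obtain q where q: "\<And>g xs. g \<in> set gs \<Longrightarrow> length xs = n \<Longrightarrow> eval (q g) xs (g xs)"
    using gs unfolding computable_def by metis
  have "eval (Comp p (map q gs)) xs (f (map (\<lambda>g. g xs) gs))" if "length xs = n" for xs
    by (rule eval.Comp[where ys = "map (\<lambda>g. g xs) gs"])
       (use p q that in \<open>auto simp: list_all2_conv_all_nth\<close>)
  then show ?thesis unfolding computable_def by blast
qed

lemma computable_comp1:
  "computable 1 (\<lambda>ys. F (ys ! 0)) \<Longrightarrow> computable n f \<Longrightarrow> computable n (\<lambda>xs. F (f xs))"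
  using computable_comp[of "[f]" "\<lambda>ys. F (ys ! 0)" n] by simp

lemma computable_comp2:
  "computable 2 (\<lambda>ys. F (ys ! 0) (ys ! 1)) \<Longrightarrow> computable n f \<Longrightarrow> computable n g \<Longrightarrow>
   computable n (\<lambda>xs. F (f xs) (g xs))"
  using computable_comp[of "[f, g]" "\<lambda>ys. F (ys ! 0) (ys ! 1)" n] by (auto simp: numeral_2_eq_2)

lemma computable_Suc: "computable n f \<Longrightarrow> computable n (\<lambda>xs. Suc (f xs))"
proof (rule computable_comp1[where F = Suc])
  have "eval Succ xs (Suc (xs ! 0))" if "length xs = 1" for xs
    using that eval.Succ[of "xs ! 0"] by (cases xs) auto
  then show "computable 1 (\<lambda>ys. Suc (ys ! 0))" unfolding computable_def by blast
qed

lemma computable_const: "computable n (\<lambda>_. c)"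
proof (induction c)
  case 0
  show ?case unfolding computable_def using eval.Zero by blast
qed (rule computable_Suc)

text \<open>Connects \<open>Prec\<close> with \<open>rec_nat\<close>, so that a function is
  computable once it is rewritten as a recursion.\<close>

lemma computable_rec_nat:
  assumes f: "computable n f" and g: "computable (Suc (Suc n)) (\<lambda>ys. G (ys ! 0) (ys ! 1) (drop 2 ys))"
    and b: "computable n b"
  shows "computable n (\<lambda>xs. rec_nat (f xs) (\<lambda>k r. G k r xs) (b xs))"
proof -
  obtain p where p: "\<And>xs. length xs = n \<Longrightarrow> eval p xs (f xs)"
    using f by (auto simp: computable_def)
  obtain q where q: "\<And>xs. length xs = Suc (Suc n) \<Longrightarrow> eval q xs (G (xs ! 0) (xs ! 1) (drop 2 xs))"
    using g by (auto simp: computable_def)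
  let ?R = "\<lambda>ys. rec_nat (f (tl ys)) (\<lambda>k r. G k r (tl ys)) (ys ! 0)"
  have "eval (Prec p q) (k # xs) (rec_nat (f xs) (\<lambda>k r. G k r xs) k)" if "length xs = n" for k xs
  proof (induction k)
    case 0
    show ?case using p[OF that] by (simp add: eval.Prec_0)
  next
    case (Suc k)
    then show ?case using q[of "k # _ # xs"] that by (auto intro: eval.Prec_Suc)
  qed
  then have "eval (Prec p q) ys (?R ys)" if "length ys = Suc n" for ys
    using that by (cases ys) auto
  then have R: "computable (Suc n) ?R" unfolding computable_def by blast
  \<comment> \<open>\<open>Prec\<close> expects the recursion variable first: the value of
    \<open>b\<close> is put in front of the unchanged arguments.\<close>
  let ?gs = "b # map (\<lambda>i xs. xs ! i) [0..<n]"
  have gs: "map (\<lambda>g. g xs) ?gs = b xs # xs" if "length xs = n" for xs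
    using that map_nth[of xs] by (simp add: comp_def)
  have "computable n (\<lambda>xs. ?R (map (\<lambda>g. g xs) ?gs))"
    by (rule computable_comp) (use R b computable_nth in auto)
  then show ?thesis
    by (rule iffD1[OF computable_cong, rotated]) (simp only: gs list.sel nth_Cons_0)
qed

lemma computable_nth_drop: "k + i < n \<Longrightarrow> computable n (\<lambda>ys. drop k ys ! i)"
  by (rule iffD1[OF computable_cong computable_nth[of "k + i"]]) auto

section \<open>Arithmetic by primitive recursion\<close>

lemma computable_add: "computable n f \<Longrightarrow> computable n g \<Longrightarrow> computable n (\<lambda>xs. f xs + g xs)"
proof (rule computable_comp2[where F = "(+)"])
  have "rec_nat y (\<lambda>k r. Suc r) x = x + y" for x y :: nat by (induction x) auto
  moreover have "computable 2 (\<lambda>ys. rec_nat (ys ! 1) (\<lambda>k r. Suc r) (ys ! 0))"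
    by (intro computable_rec_nat[where G = "\<lambda>k r xs. Suc r"] computable_nth computable_Suc) auto
  ultimately show "computable 2 (\<lambda>ys. ys ! 0 + ys ! 1)" by simp
qed

lemma computable_mult: "computable n f \<Longrightarrow> computable n g \<Longrightarrow> computable n (\<lambda>xs. f xs * g xs)"
proof (rule computable_comp2[where F = "(*)"])
  have "rec_nat 0 (\<lambda>k r. r + y) x = x * y" for x y :: nat by (induction x) auto
  moreover have "computable 2 (\<lambda>ys. rec_nat 0 (\<lambda>k r. r + ys ! 1) (ys ! 0))"
    by (intro computable_rec_nat[where G = "\<lambda>k r xs. r + xs ! 1"] computable_nth computable_nth_drop
        computable_add computable_const) auto
  ultimately show "computable 2 (\<lambda>ys. ys ! 0 * ys ! 1)" by simp
qed

lemma computable_diff: "computable n f \<Longrightarrow> computable n g \<Longrightarrow> computable n (\<lambda>xs. f xs - g xs)"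
proof (rule computable_comp2[where F = "(-)"])
  have "computable 1 (\<lambda>ys. rec_nat 0 (\<lambda>k r. k) (ys ! 0))"
    by (intro computable_rec_nat[where G = "\<lambda>k r xs. k"] computable_nth computable_const) auto
  moreover have "rec_nat 0 (\<lambda>k r. k) x = x - 1" for x :: nat by (cases x) auto
  ultimately have pred: "computable n (\<lambda>xs. h xs - 1)" if "computable n h" for n h
    using computable_comp1[of "\<lambda>x. x - 1" n h] that by simp
  have "rec_nat x (\<lambda>k r. r - 1) y = x - y" for x y :: nat by (induction y) auto
  moreover have "computable 2 (\<lambda>ys. rec_nat (ys ! 0) (\<lambda>k r. r - 1) (ys ! 1))"
    by (intro computable_rec_nat[where G = "\<lambda>k r xs. r - 1"] computable_nth pred) auto
  ultimately show "computable 2 (\<lambda>ys. ys ! 0 - ys ! 1)" by simp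
qed

lemma computable_power: "computable n f \<Longrightarrow> computable n (\<lambda>xs. c ^ f xs)"
proof (rule computable_comp1[where F = "(^) c"])
  have "rec_nat 1 (\<lambda>k r. c * r) x = c ^ x" for x :: nat by (induction x) auto
  moreover have "computable 1 (\<lambda>ys. rec_nat 1 (\<lambda>k r. c * r) (ys ! 0))"
    by (intro computable_rec_nat[where G = "\<lambda>k r xs. c * r"] computable_nth computable_mult
        computable_const) auto
  ultimately show "computable 1 (\<lambda>ys. c ^ (ys ! 0))" by simp
qed

lemma computable_funpow:
  assumes "computable 1 (\<lambda>ys. F (ys ! 0))" "computable n k" "computable n f"
  shows "computable n (\<lambda>xs. (F ^^ k xs) (f xs))"
proof -
  have "rec_nat x (\<lambda>_. F) m = (F ^^ m) x" for x m by (induction m) auto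
  moreover have "computable n (\<lambda>xs. rec_nat (f xs) (\<lambda>_. F) (k xs))"
    by (intro computable_rec_nat[where G = "\<lambda>k r xs. F r"] computable_comp1[OF assms(1)]
        computable_nth assms) auto
  ultimately show ?thesis by simp
qed

lemma computable_prod_encode:
  "computable n f \<Longrightarrow> computable n g \<Longrightarrow> computable n (\<lambda>xs. prod_encode (f xs, g xs))"
proof -
  have "rec_nat 0 (\<lambda>k r. r + Suc k) x = triangle x" for x :: nat by (induction x) auto
  moreover have "computable 1 (\<lambda>ys. rec_nat 0 (\<lambda>k r. r + Suc k) (ys ! 0))"
    by (intro computable_rec_nat[where G = "\<lambda>k r xs. r + Suc k"] computable_nth computable_add
        computable_Suc computable_const) auto
  ultimately have tri: "computable 1 (\<lambda>ys. triangle (ys ! 0))" by simp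
  show "computable n f \<Longrightarrow> computable n g \<Longrightarrow> ?thesis"
    unfolding prod_encode_def prod.case
    by (intro computable_add computable_comp1[OF tri])
qed

section \<open>Decidable predicates and bounded quantifiers\<close>

lemma of_bool_not_nat: "(of_bool (\<not> P) :: nat) = 1 - of_bool P"
  by simp

lemma decides_not: "decides n P \<Longrightarrow> decides n (\<lambda>xs. \<not> P xs)"
  unfolding of_bool_not_nat by (intro computable_diff computable_const)

lemma decides_conj: "decides n P \<Longrightarrow> decides n Q \<Longrightarrow> decides n (\<lambda>xs. P xs \<and> Q xs)"
  unfolding of_bool_conj by (rule computable_mult)

lemma decides_imp: "decides n P \<Longrightarrow> decides n Q \<Longrightarrow> decides n (\<lambda>xs. P xs \<longrightarrow> Q xs)"
  using decides_not[OF decides_conj[OF _ decides_not], of n P Q] by simp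

lemma decides_le: "computable n f \<Longrightarrow> computable n g \<Longrightarrow> decides n (\<lambda>xs. f xs \<le> g xs)"
proof -
  have "of_bool (x \<le> y) = 1 - (x - y)" for x y :: nat by simp
  then show "computable n f \<Longrightarrow> computable n g \<Longrightarrow> ?thesis"
    by (simp only:) (intro computable_diff computable_const)
qed

text \<open>A bounded universal quantifier is a product of truth values, computed by recursion on
  the bound.\<close>

lemma decides_all_less:
  assumes P: "decides (Suc n) (\<lambda>ys. P (ys ! 0) (drop 1 ys))" and b: "computable n b"
  shows "decides n (\<lambda>xs. \<forall>a < b xs. P a xs)"
proof -
  have "rec_nat 1 (\<lambda>k r. r * of_bool (P k xs)) m = (of_bool (\<forall>a < m. P a xs) :: nat)" for m xs
    by (induction m) (auto simp: less_Suc_eq)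
  moreover have "computable n (\<lambda>xs. rec_nat 1 (\<lambda>k r. r * of_bool (P k xs)) (b xs))"
  proof (intro computable_rec_nat[where G = "\<lambda>k r xs. r * of_bool (P k xs)"] computable_mult
      computable_nth computable_const b)
    \<comment> \<open>The recursion step receives the accumulated product at index 1; these
      projections skip it before \<open>P\<close> is evaluated.\<close>
    let ?gs = "(\<lambda>xs. xs ! 0) # map (\<lambda>i xs. xs ! Suc (Suc i)) [0..<n]"
    have gs: "map (\<lambda>g. g ys) ?gs = ys ! 0 # drop 2 ys" if "length ys = Suc (Suc n)" for ys :: "nat list"
      using that by (auto intro!: nth_equalityI simp: nth_Cons split: nat.splits)
    have "computable (Suc (Suc n)) (\<lambda>ys. (\<lambda>zs. of_bool (P (zs ! 0) (drop 1 zs)) :: nat) (map (\<lambda>g. g ys) ?gs))"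
      by (rule computable_comp) (use P computable_nth in auto)
    then show "computable (Suc (Suc n)) (\<lambda>ys. of_bool (P (ys ! 0) (drop 2 ys)))"
      by (rule iffD1[OF computable_cong, rotated]) (simp only: gs, simp)
  qed simp
  ultimately show ?thesis by simp
qed

lemma decides_all_le:
  "decides (Suc n) (\<lambda>ys. P (ys ! 0) (drop 1 ys)) \<Longrightarrow> computable n b \<Longrightarrow>
   decides n (\<lambda>xs. \<forall>a \<le> b xs. P a xs)"
  using decides_all_less[of n P "\<lambda>xs. Suc (b xs)"] by (simp add: less_Suc_eq_le computable_Suc)

text \<open>Membership of \<open>x\<close> is the parity of \<open>m\<close> after \<open>x\<close>
  halvings.\<close>

lemma decides_mem_set_decode:
  "computable n f \<Longrightarrow> computable n g \<Longrightarrow> decides n (\<lambda>xs. f xs \<in> set_decode (g xs))"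
proof (rule computable_comp2[where F = "\<lambda>x m. of_bool (x \<in> set_decode m)"])
  \<comment> \<open>Uses \<open>Suc k div 2 = k - k div 2\<close>.\<close>
  have "rec_nat 0 (\<lambda>k r. k - r) x = x div 2" for x :: nat
    by (induction x) auto
  moreover have "computable 1 (\<lambda>ys. rec_nat 0 (\<lambda>k r. k - r) (ys ! 0))"
    by (intro computable_rec_nat[where G = "\<lambda>k r xs. k - r"] computable_nth computable_diff
        computable_const) auto
  ultimately have half: "computable n (\<lambda>xs. h xs div 2)" if "computable n h" for n h
    using computable_comp1[of "\<lambda>x. x div 2" n h] that by simp
  have "computable 2 (\<lambda>ys. ((\<lambda>m. m div 2) ^^ (ys ! 0)) (ys ! 1))"
    by (intro computable_funpow half computable_nth) auto
  moreover have "((\<lambda>m. m div 2) ^^ x) m = m div 2 ^ x" for x m :: nat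
    by (induction x) (simp_all add: div_mult2_eq[symmetric] mult.commute)
  ultimately have "computable 2 (\<lambda>ys. ys ! 1 div 2 ^ (ys ! 0))" by simp
  moreover have "of_bool (x \<in> set_decode m) = m div 2 ^ x - 2 * (m div 2 ^ x div 2)" for x m
    by (simp add: set_decode_def minus_mult_div_eq_mod mod_2_eq_odd)
  ultimately show "computable 2 (\<lambda>ys. of_bool (ys ! 0 \<in> set_decode (ys ! 1)))"
    by (simp only:) (intro computable_diff computable_mult computable_const half)
qed

section \<open>Deciding bounded derivability\<close>

text \<open>A number \<open>m\<close> encodes, through its binary digits, a relation between numbers up to \<open>B\<close>.\<close>

definition rel :: "nat \<Rightarrow> nat \<Rightarrow> nat \<Rightarrow> nat \<Rightarrow> bool" where
  "rel B m u v \<longleftrightarrow> u \<le> B \<and> v \<le> B \<and> u * Suc B + v \<in> set_decode m"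

definition fus :: "nat \<Rightarrow> nat \<Rightarrow> nat" where "fus a b = 6 * prod_encode (a, b) + 1"
definition res :: "nat \<Rightarrow> nat \<Rightarrow> nat" where "res a b = 6 * prod_encode (a, b) + 2"
definition con :: "nat \<Rightarrow> nat \<Rightarrow> nat" where "con a b = 6 * prod_encode (a, b) + 3"
definition dis :: "nat \<Rightarrow> nat \<Rightarrow> nat" where "dis a b = 6 * prod_encode (a, b) + 4"
definition ng :: "nat \<Rightarrow> nat" where "ng a = 6 * a + 5"

lemma code_eqs:
  "code (\<alpha> \<^bold>\<cdot> \<beta>) = fus (code \<alpha>) (code \<beta>)" "code (\<alpha> \<^bold>\<setminus> \<beta>) = res (code \<alpha>) (code \<beta>)"
  "code (\<alpha> \<^bold>\<and> \<beta>) = con (code \<alpha>) (code \<beta>)" "code (\<alpha> \<^bold>\<or> \<beta>) = dis (code \<alpha>) (code \<beta>)"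
  "code (\<^bold>\<not> \<alpha>) = ng (code \<alpha>)"
  by (simp_all add: fus_def res_def con_def dis_def ng_def)

text \<open>The rules of \<open>bqG\<close> have at most three metavariables, so closure under all
  of them takes only three bounded quantifiers over codes.\<close>

definition rule_closed :: "nat \<Rightarrow> nat \<Rightarrow> nat \<Rightarrow> nat \<Rightarrow> nat \<Rightarrow> bool" where
  "rule_closed B m a b c \<longleftrightarrow>
     rel B m a a \<and>
     (rel B m (fus a b) c \<longrightarrow> res a c \<le> B \<longrightarrow> rel B m b (res a c)) \<and>
     (rel B m b (res a c) \<longrightarrow> fus a b \<le> B \<longrightarrow> rel B m (fus a b) c) \<and>
     (rel B m a b \<longrightarrow> con a c \<le> B \<longrightarrow> rel B m (con a c) b) \<and>
     (rel B m a b \<longrightarrow> con c a \<le> B \<longrightarrow> rel B m (con c a) b) \<and>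
     (rel B m a b \<longrightarrow> rel B m a c \<longrightarrow> con b c \<le> B \<longrightarrow> rel B m a (con b c)) \<and>
     (rel B m a b \<longrightarrow> rel B m c b \<longrightarrow> dis a c \<le> B \<longrightarrow> rel B m (dis a c) b) \<and>
     (rel B m a b \<longrightarrow> dis b c \<le> B \<longrightarrow> rel B m a (dis b c)) \<and>
     (rel B m a b \<longrightarrow> dis c b \<le> B \<longrightarrow> rel B m a (dis c b)) \<and>
     (rel B m (fus a b) (ng c) \<longrightarrow> fus c b \<le> B \<longrightarrow> ng a \<le> B \<longrightarrow> rel B m (fus c b) (ng a)) \<and>
     (rel B m a (ng c) \<longrightarrow> ng a \<le> B \<longrightarrow> rel B m c (ng a)) \<and>
     (rel B m a b \<longrightarrow> rel B m b c \<longrightarrow> rel B m a c)"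

definition closed :: "nat \<Rightarrow> nat \<Rightarrow> bool" where
  "closed B m \<longleftrightarrow> (\<forall>a \<le> B. \<forall>b \<le> B. \<forall>c \<le> B. rule_closed B m a b c)"

lemma bqG_imp_rel:
  assumes "bqG B \<alpha> \<beta>" "closed B m"
  shows "rel B m (code \<alpha>) (code \<beta>)"
proof -
  have r: "rule_closed B m (code \<alpha>) (code \<beta>) (code \<gamma>)"
    if "code \<alpha> \<le> B" "code \<beta> \<le> B" "code \<gamma> \<le> B" for \<alpha> \<beta> \<gamma>
    using assms(2) that by (simp add: closed_def)
  from assms(1) show ?thesis
  proof (induction rule: bqG.induct)
    case (Id \<alpha>)
    then show ?case using r[of \<alpha> \<alpha> \<alpha>] by (simp add: rule_closed_def)
  next
    case (RES \<alpha> \<beta> \<gamma>)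
    then have "code \<alpha> \<le> B" "code \<beta> \<le> B" "code \<gamma> \<le> B"
      using bqG_code_le[OF RES.hyps(1)] code_subformula_less(1)[of \<alpha> \<beta>] code_subformula_less(2)[of \<beta> \<alpha>]
      by linarith+
    from r[OF this] show ?case using RES by (simp add: rule_closed_def code_eqs del: code.simps)
  next
    case (RES_inv \<beta> \<alpha> \<gamma>)
    then have "code \<alpha> \<le> B" "code \<beta> \<le> B" "code \<gamma> \<le> B"
      using bqG_code_le[OF RES_inv.hyps(1)] code_subformula_less(3)[of \<alpha> \<gamma>] code_subformula_less(4)[of \<gamma> \<alpha>]
      by linarith+
    from r[OF this] show ?case using RES_inv by (simp add: rule_closed_def code_eqs del: code.simps)
  next
    case (conL1 \<alpha> \<beta> \<gamma>)
    then have "code \<alpha> \<le> B" "code \<beta> \<le> B" "code \<gamma> \<le> B"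
      using bqG_code_le[OF conL1.hyps(1)] code_subformula_less(6)[of \<gamma> \<alpha>] by linarith+
    from r[OF this] show ?case using conL1 by (simp add: rule_closed_def code_eqs del: code.simps)
  next
    case (conL2 \<alpha> \<beta> \<gamma>)
    then have "code \<alpha> \<le> B" "code \<beta> \<le> B" "code \<gamma> \<le> B"
      using bqG_code_le[OF conL2.hyps(1)] code_subformula_less(5)[of \<gamma> \<alpha>] by linarith+
    from r[OF this] show ?case using conL2 by (simp add: rule_closed_def code_eqs del: code.simps)
  next
    case (conR \<alpha> \<beta> \<gamma>)
    then have "code \<alpha> \<le> B" "code \<beta> \<le> B" "code \<gamma> \<le> B" using bqG_code_le by blast+
    from r[OF this] show ?case using conR by (simp add: rule_closed_def code_eqs del: code.simps)
  next
    case (disL \<alpha> \<beta> \<gamma>)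
    then have "code \<alpha> \<le> B" "code \<beta> \<le> B" "code \<gamma> \<le> B" using bqG_code_le by blast+
    from r[OF this] show ?case using disL by (simp add: rule_closed_def code_eqs del: code.simps)
  next
    case (disR1 \<alpha> \<beta> \<gamma>)
    then have "code \<alpha> \<le> B" "code \<beta> \<le> B" "code \<gamma> \<le> B"
      using bqG_code_le[OF disR1.hyps(1)] code_subformula_less(8)[of \<gamma> \<beta>] by linarith+
    from r[OF this] show ?case using disR1 by (simp add: rule_closed_def code_eqs del: code.simps)
  next
    case (disR2 \<alpha> \<beta> \<gamma>)
    then have "code \<alpha> \<le> B" "code \<beta> \<le> B" "code \<gamma> \<le> B"
      using bqG_code_le[OF disR2.hyps(1)] code_subformula_less(7)[of \<gamma> \<beta>] by linarith+
    from r[OF this] show ?case using disR2 by (simp add: rule_closed_def code_eqs del: code.simps)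
  next
    case (neg \<alpha> \<beta> \<gamma>)
    then have "code \<alpha> \<le> B" "code \<beta> \<le> B" "code \<gamma> \<le> B"
      using bqG_code_le[OF neg.hyps(1)] code_subformula_less(1)[of \<alpha> \<beta>] code_subformula_less(2)[of \<beta> \<alpha>]
        code_subformula_less(9)[of \<gamma>]
      by linarith+
    from r[OF this] show ?case using neg by (simp add: rule_closed_def code_eqs del: code.simps)
  next
    case (MN \<alpha> \<gamma>)
    then have "code \<alpha> \<le> B" "code \<alpha> \<le> B" "code \<gamma> \<le> B"
      using bqG_code_le[OF MN.hyps(1)] code_subformula_less(9)[of \<gamma>] by linarith+
    from r[OF this] show ?case using MN by (simp add: rule_closed_def code_eqs del: code.simps)
  next
    case (Cut \<alpha> \<beta> \<gamma>)
    then have "code \<alpha> \<le> B" "code \<beta> \<le> B" "code \<gamma> \<le> B" using bqG_code_le by blast+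
    from r[OF this] show ?case using Cut by (simp add: rule_closed_def)
  qed
qed

lemma set_encode_less:
  assumes "A \<subseteq> {..<n}"
  shows "set_encode A < 2 ^ n"
proof -
  have "set_encode A \<le> (\<Sum>x<n. 2 ^ x)"
    unfolding set_encode_def using assms by (intro sum_mono2) auto
  also have "\<dots> < 2 ^ n" by (induction n) auto
  finally show ?thesis .
qed

text \<open>Bounded derivability is itself a finite relation closed under the rules;
  \<open>m\<close> is its encoding, whose digits sit at positions below
  \<open>Suc B * Suc B\<close>.\<close>

lemma closed_least:
  obtains m where "closed B m" "m < 2 ^ (Suc B * Suc B)"
    "\<And>\<alpha> \<beta>. rel B m (code \<alpha>) (code \<beta>) \<Longrightarrow> bqG B \<alpha> \<beta>"
proof -
  let ?A = "{code \<alpha> * Suc B + code \<beta> | \<alpha> \<beta>. bqG B \<alpha> \<beta>}"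
  have A: "?A \<subseteq> {..<Suc B * Suc B}"
  proof
    fix x assume "x \<in> ?A"
    then obtain \<alpha> \<beta> where x: "x = code \<alpha> * Suc B + code \<beta>" "bqG B \<alpha> \<beta>" by blast
    then have "code \<alpha> \<le> B" "code \<beta> < Suc B" using bqG_code_le by (auto simp: less_Suc_eq_le)
    then have "code \<alpha> * Suc B + code \<beta> < B * Suc B + Suc B"
      by (intro add_le_less_mono mult_le_mono1)
    then show "x \<in> {..<Suc B * Suc B}" by (simp add: x(1) add.commute)
  qed
  then have dec: "set_decode (set_encode ?A) = ?A" by (intro set_encode_inverse) (rule finite_subset, auto)
  have rel: "rel B (set_encode ?A) (code \<alpha>) (code \<beta>) \<longleftrightarrow> bqG B \<alpha> \<beta>" for \<alpha> \<beta>
  proof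
    assume "rel B (set_encode ?A) (code \<alpha>) (code \<beta>)"
    then obtain \<alpha>' \<beta>' where e: "code \<alpha> * Suc B + code \<beta> = code \<alpha>' * Suc B + code \<beta>'"
      and le: "code \<beta> < Suc B" and b: "bqG B \<alpha>' \<beta>'"
      unfolding rel_def dec by auto
    have le': "code \<beta>' < Suc B" using bqG_code_le[OF b] by simp
    \<comment> \<open>Both codes are recovered as quotient and remainder modulo
      \<open>Suc B\<close>.\<close>
    have "code \<alpha> = code \<alpha>'" "code \<beta> = code \<beta>'"
      using arg_cong[OF e, of "\<lambda>x. x div Suc B"] arg_cong[OF e, of "\<lambda>x. x mod Suc B"] le le'
      by (simp_all del: mult_Suc_right)
    then show "bqG B \<alpha> \<beta>" using b code_inj by blast
  next
    assume "bqG B \<alpha> \<beta>"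
    then show "rel B (set_encode ?A) (code \<alpha>) (code \<beta>)"
      using bqG_code_le unfolding rel_def dec by blast
  qed
  have closed: "rule_closed B (set_encode ?A) (code \<alpha>) (code \<beta>) (code \<gamma>)"
    if "code \<alpha> \<le> B" for \<alpha> \<beta> \<gamma>
    unfolding rule_closed_def code_eqs[symmetric] rel
    by (intro conjI impI)
       (rule bqG.Id[OF that], erule (1) bqG.RES, erule (1) bqG.RES_inv, erule (1) bqG.conL1,
        erule (1) bqG.conL2, erule (2) bqG.conR, erule (2) bqG.disL, erule (1) bqG.disR1,
        erule (1) bqG.disR2, erule (2) bqG.neg, erule (1) bqG.MN, erule (1) bqG.Cut)
  \<comment> \<open>Every number is the code of a formula, so closure for formulas gives closure for
    numbers.\<close>
  have "rule_closed B (set_encode ?A) a b c" if "a \<le> B" for a b c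
    using closed that code_surj[of a] code_surj[of b] code_surj[of c] by blast
  then have "closed B (set_encode ?A)" by (simp add: closed_def)
  then show thesis using that set_encode_less[OF A] rel by blast
qed

section \<open>The decision procedure\<close>

definition bound :: "nat \<Rightarrow> nat" where
  "bound N = (code_bound ^^ ((N + 1) * (N + 1) + N + 4)) N"

text \<open>A bounded derivation lies in every closed relation; conversely, the encoding of bounded
  derivability is among the relations tested.\<close>

lemma qG_iff:
  fixes \<alpha> \<beta> :: form
  defines "B \<equiv> bound (2 * (code \<alpha> + code \<beta>))"
  shows "\<turnstile> \<alpha> \<^bold>\<Rightarrow> \<beta> \<longleftrightarrow> (\<forall>m < 2 ^ (Suc B * Suc B). closed B m \<longrightarrow> rel B m (code \<alpha>) (code \<beta>))"
proof
  assume "\<turnstile> \<alpha> \<^bold>\<Rightarrow> \<beta>"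
  then have "bqG B \<alpha> \<beta>" unfolding B_def bound_def
    by (rule qG_imp_bqG[where m = "code \<alpha> + code \<beta>"]) auto
  then show "\<forall>m < 2 ^ (Suc B * Suc B). closed B m \<longrightarrow> rel B m (code \<alpha>) (code \<beta>)"
    using bqG_imp_rel by blast
next
  assume "\<forall>m < 2 ^ (Suc B * Suc B). closed B m \<longrightarrow> rel B m (code \<alpha>) (code \<beta>)"
  then show "\<turnstile> \<alpha> \<^bold>\<Rightarrow> \<beta>" using closed_least[of B] bqG_imp_qG by metis
qed

lemmas computable_arith = computable_nth computable_nth_drop computable_const computable_Suc
  computable_add computable_mult computable_power computable_prod_encode

lemma decides_rel:
  "computable n B \<Longrightarrow> computable n m \<Longrightarrow> computable n u \<Longrightarrow> computable n v \<Longrightarrow>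
   decides n (\<lambda>xs. rel (B xs) (m xs) (u xs) (v xs))"
  unfolding rel_def by (intro decides_conj decides_le decides_mem_set_decode computable_arith)

lemma decides_rule_closed:
  assumes "computable n B" "computable n m" "computable n a" "computable n b" "computable n c"
  shows "decides n (\<lambda>xs. rule_closed (B xs) (m xs) (a xs) (b xs) (c xs))"
  unfolding rule_closed_def fus_def res_def con_def dis_def ng_def
  by (intro decides_conj decides_imp decides_le decides_rel computable_add computable_mult
      computable_prod_encode computable_const assms)

lemma decides_closed:
  assumes "computable n B" "computable n m"
  shows "decides n (\<lambda>xs. closed (B xs) (m xs))"
\<comment> \<open>At arity 2, \<open>B\<close> and \<open>m\<close> are plain projections, and each
  bounded quantifier only shifts their indices.\<close>
proof (rule computable_comp2[OF _ assms, where F = "\<lambda>B m. of_bool (closed B m)"])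
  show "decides 2 (\<lambda>ys. closed (ys ! 0) (ys ! 1))"
    unfolding closed_def
    by (intro decides_all_le decides_rule_closed) (simp_all add: computable_nth computable_nth_drop)
qed

lemma computable_bound: "computable n f \<Longrightarrow> computable n (\<lambda>xs. bound (f xs))"
  unfolding bound_def
  by (intro computable_funpow computable_arith) (auto simp: code_bound_def intro!: computable_arith)

theorem theorem8: "decidable (\<lambda>\<alpha> \<beta>. \<turnstile> \<alpha> \<^bold>\<Rightarrow> \<beta>)"
proof -
  let ?B = "\<lambda>xs. bound (2 * (xs ! 0 + xs ! 1))"
  \<comment> \<open>The criterion of \<open>qG_iff\<close> as a predicate on the two codes: a
    bounded search over encoded relations.\<close>
  have "decides 2 (\<lambda>xs. \<forall>m < 2 ^ (Suc (?B xs) * Suc (?B xs)).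
      closed (?B xs) m \<longrightarrow> rel (?B xs) m (xs ! 0) (xs ! 1))"
    by (intro decides_all_less decides_imp decides_closed decides_rel computable_bound computable_arith)
       auto
  then obtain p where p: "\<And>xs. length xs = 2 \<Longrightarrow> eval p xs
      (of_bool (\<forall>m < 2 ^ (Suc (?B xs) * Suc (?B xs)). closed (?B xs) m \<longrightarrow> rel (?B xs) m (xs ! 0) (xs ! 1)))"
    unfolding computable_def by blast
  have "eval p [code \<alpha>, code \<beta>] (if \<turnstile> \<alpha> \<^bold>\<Rightarrow> \<beta> then 1 else 0)" for \<alpha> \<beta>
    using p[of "[code \<alpha>, code \<beta>]"] unfolding qG_iff[of \<alpha> \<beta>] of_bool_def
    by (simp only: list.size nth_Cons_0 nth_Cons_Suc One_nat_def numeral_2_eq_2 add_0 add_Suc_right add_0_right)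
  then show ?thesis unfolding decidable_def by blast
qed

end
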